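(* Let $P\in\mathbb R^n$, let $\mu_j\in\overline{\mathcal M}$ converge weak-* to $\mu\in\overline{\mathcal M}$, and suppose that $\lim_{j\to\infty}F(\mu_j,P)=F(\mu,P)$. Let $\nu_j$ be the weak solutions of $F(\mu_j,P)$. Then there is a subsequence of $(\nu_j)$ which converges weakly, as measures on $\mathbb T^n\times\mathbb R^n$, to a weak solution $\nu$ of $F(\mu,P)$. Moreover, for every $\mu\in\overline{\mathcal M}$ there exists a sequence $\mu_j=\rho_j\,dx\in\overline{\mathcal M}$ converging weak-* to $\mu$, with $\rho_j\in C^\infty(\mathbb T^n)$ and $\rho_j>0$ on $\mathbb T^n$, such that $\lim_{j\to\infty}F(\mu_j,P)=F(\mu,P)$ for every $P\in\mathbb R^n$.
   Context: $\mathbb T^n=\mathbb R^n/\mathbb Z^n$ is the flat torus and $\overline{\mathcal M}$ is the set of Borel probability measures on $\mathbb T^n$; weak-* convergence is convergence against functions in $C(\mathbb T^n)$. For $\mu\in\overline{\mathcal M}$, $P\in\mathbb R^n$: $$F(\mu,P)=\frac12\inf_{\phi\in C^1(\mathbb T^n)}\int_{\mathbb T^n}|\nabla\phi+P|^2\,d\mu.$$ $\Lambda_\mu$ is the set of Borel probability measures $\nu$ on $\mathbb T^n\times\mathbb R^n$ (points $(x,p)$) with marginal $\mu$ on $\mathbb T^n$, $\int|p|^2d\nu<\infty$, and $\int p\cdot\nabla\theta(x)\,d\nu=0$ for all $\theta\in C^1(\mathbb T^n)$. A measure $\nu\in\Lambda_\mu$ is a weak solution of $F(\mu,P)$ if $\int[\frac{|p|^2}{2}-p\cdot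 P]\,d\nu\le\int[\frac{|p|^2}{2}-p\cdot P]\,d\xi$ for all $\xi\in\Lambda_\mu$. (A weak solution exists and is unique for every $\mu$ and $P$.) *)

theory Defs
  imports "HOL-Probability.Probability"
begin

definition torus_rel :: "real ^ 'n \<Rightarrow> real ^ 'n \<Rightarrow> bool" where
  "torus_rel x y \<longleftrightarrow> (\<forall>i. x $ i - y $ i \<in> \<int>)"

lemma equivp_torus_rel: "equivp torus_rel"
proof (rule equivpI)
  show "reflp torus_rel"
    by (simp add: reflp_def torus_rel_def)
  show "symp torus_rel"
    unfolding symp_def torus_rel_def by (metis Ints_minus minus_diff_eq)
  show "transp torus_rel"
  proof (rule transpI)
    fix x y z :: "real ^ 'n"
    assume "torus_rel x y" "torus_rel y z"
    then have "(x $ i - y $ i) + (y $ i - z $ i) \<in> \<int>" for i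
      unfolding torus_rel_def by (blast intro: Ints_add)
    then show "torus_rel x z"
      by (simp add: torus_rel_def)
  qed
qed

text \<open>
  The projection from \<open>real ^ 'n\<close> onto the torus is \<open>abs_torus\<close>; \<open>rep_torus\<close> picks some
  representative of a point.
\<close>

quotient_type (overloaded) 'n torus = "real ^ ('n::finite)" / torus_rel
  by (rule equivp_torus_rel)

text \<open>The quotient topology from \<open>real ^ 'n\<close>.\<close>

instantiation torus :: (finite) topological_space
begin

definition open_torus :: "'a torus set \<Rightarrow> bool" where
  "open_torus U \<longleftrightarrow> open (abs_torus -` U)"

instance
proof
  show "open (UNIV :: 'a torus set)"
    by (simp add: open_torus_def)
next
  fix S T :: "'a torus set"
  assume "open S" "open T"
  then show "open (S \<inter> T)"
    by (simp add: open_torus_def vimage_Int open_Int)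
next
  fix K :: "'a torus set set"
  assume "\<forall>S\<in>K. open S"
  then show "open (\<Union>K)"
    by (simp add: open_torus_def vimage_Union open_UN)
qed

end

text \<open>Lebesgue measure \<open>dx\<close> on the torus: the image of Lebesgue measure on \<open>[0,1)\<^sup>n\<close>.\<close>

definition torus_lebesgue :: "'n::finite torus measure" where
  "torus_lebesgue =
     distr (restrict_space lborel {x :: real ^ 'n. \<forall>i. 0 \<le> x $ i \<and> x $ i < 1}) borel abs_torus"

primrec Ck :: "nat \<Rightarrow> (real ^ ('n::finite) \<Rightarrow> real) \<Rightarrow> bool" where
  "Ck 0 f \<longleftrightarrow> continuous_on UNIV f"
| "Ck (Suc k) f \<longleftrightarrow>
     (\<forall>x. f differentiable (at x)) \<and>
     (\<forall>i. Ck k (\<lambda>x. frechet_derivative f (at x) (axis i 1)))"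

definition C1_torus :: "('n::finite torus \<Rightarrow> real) \<Rightarrow> bool" where
  "C1_torus \<phi> \<longleftrightarrow> Ck 1 (\<phi> \<circ> abs_torus)"

definition smooth_torus :: "('n::finite torus \<Rightarrow> real) \<Rightarrow> bool" where
  "smooth_torus \<phi> \<longleftrightarrow> (\<forall>k. Ck k (\<phi> \<circ> abs_torus))"

text \<open>
  Since \<open>\<phi> \<circ> abs_torus\<close> is periodic, its gradient is the same at all representatives of a point.
\<close>

definition torus_grad :: "('n::finite torus \<Rightarrow> real) \<Rightarrow> 'n torus \<Rightarrow> real ^ 'n" where
  "torus_grad \<phi> q = (THE D. GDERIV (\<phi> \<circ> abs_torus) (rep_torus q) :> D)"

definition borel_probs :: "'a::topological_space measure set" where
  "borel_probs = {\<mu>. prob_space \<mu> \<and> sets \<mu> = sets borel}"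

definition weak_star_conv :: "(nat \<Rightarrow> 'n::finite torus measure) \<Rightarrow> 'n torus measure \<Rightarrow> bool" where
  "weak_star_conv \<mu>s \<mu> \<longleftrightarrow>
     (\<forall>f :: 'n torus \<Rightarrow> real. continuous_on UNIV f \<longrightarrow>
        (\<lambda>j. \<integral>x. f x \<partial>\<mu>s j) \<longlonglongrightarrow> (\<integral>x. f x \<partial>\<mu>))"

definition weak_conv_meas ::
    "(nat \<Rightarrow> 'a::topological_space measure) \<Rightarrow> 'a measure \<Rightarrow> bool" where
  "weak_conv_meas \<nu>s \<nu> \<longleftrightarrow>
     (\<forall>f :: 'a \<Rightarrow> real. continuous_on UNIV f \<and> bounded (range f) \<longrightarrow>
        (\<lambda>j. \<integral>z. f z \<partial>\<nu>s j) \<longlonglongrightarrow> (\<integral>z. f z \<partial>\<nu>))"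

definition F :: "'n::finite torus measure \<Rightarrow> real ^ 'n \<Rightarrow> real" where
  "F \<mu> P = 1 / 2 * (INF \<phi>\<in>{\<phi>. C1_torus \<phi>}. \<integral>x. (norm (torus_grad \<phi> x + P))\<^sup>2 \<partial>\<mu>)"

definition Lam :: "'n::finite torus measure \<Rightarrow> ('n torus \<times> (real ^ 'n)) measure set" where
  "Lam \<mu> = {\<nu> \<in> borel_probs.
     distr \<nu> borel fst = \<mu> \<and>
     integrable \<nu> (\<lambda>(x, p). (norm p)\<^sup>2) \<and>
     (\<forall>\<theta>. C1_torus \<theta> \<longrightarrow> (\<integral>(x, p). p \<bullet> torus_grad \<theta> x \<partial>\<nu>) = 0)}"

definition weak_solution ::
    "'n::finite torus measure \<Rightarrow> real ^ 'n \<Rightarrow> ('n torus \<times> (real ^ 'n)) measure \<Rightarrow> bool" where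
  "weak_solution \<mu> P \<nu> \<longleftrightarrow> \<nu> \<in> Lam \<mu> \<and>
     (\<forall>\<xi>\<in>Lam \<mu>. (\<integral>(x, p). (norm p)\<^sup>2 / 2 - p \<bullet> P \<partial>\<nu>) \<le> (\<integral>(x, p). (norm p)\<^sup>2 / 2 - p \<bullet> P \<partial>\<xi>))"

end

theory Submission
  imports Defs
begin

text \<open>
  Completing the square gives, for \<open>\<xi> \<in> Lam \<mu>\<close> and \<open>\<phi>\<close> of class \<open>C\<^sup>1\<close>, the identity
  \<open>\<integral> \<bar>p - (\<nabla>\<phi> + P)\<bar>\<^sup>2 d\<xi> = 2 action(\<xi>) + \<integral> \<bar>\<nabla>\<phi> + P\<bar>\<^sup>2 d\<mu>\<close>. A minimising sequence \<open>\<phi>\<^sub>k\<close> for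
  \<open>F \<mu> P\<close> makes \<open>\<nabla>\<phi>\<^sub>k + P\<close> a Cauchy sequence in \<open>L\<^sup>2(\<mu>)\<close>, and the graph of its limit carries an
  element of \<open>Lam \<mu>\<close> with action \<open>- F \<mu> P\<close>. Hence the weak solutions are exactly the elements of
  action \<open>- F \<mu> P\<close>, and the left-hand side above measures how far such a \<open>\<xi>\<close> is from the graph of the
  continuous map \<open>\<nabla>\<phi> + P\<close>. If \<open>\<phi>\<close> is nearly optimal for \<open>\<mu>\<close>, then by convergence of the values
  of \<open>F\<close> it is nearly optimal for \<open>\<mu>\<^sub>j\<close> as well, so both \<open>\<nu>\<^sub>j\<close> and \<open>\<nu>\<close> are close to that graph.
  This gives convergence of the whole sequence, without a compactness argument.

  For the approximation, \<open>\<mu>\<close> is convolved with the kernels \<open>H\<^sup>j / \<integral> H\<^sup>j\<close>, where \<open>H\<close> is a positive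
  trigonometric polynomial with its unique maximum at \<open>0\<close>. The energy of the convolution is an average
  of energies of \<open>\<mu>\<close> for translated test functions, so convolution does not decrease \<open>F\<close>; as an
  infimum of weak-* continuous functionals, \<open>F\<close> is upper semicontinuous.
\<close>

section \<open>Topology of the torus\<close>

lemma abs_torus_eq_iff: "abs_torus x = abs_torus y \<longleftrightarrow> torus_rel x y"
  using torus.abs_eq_iff by blast

lemma abs_rep_torus [simp]: "abs_torus (rep_torus q) = q"
  by (rule Quotient_abs_rep[OF Quotient_torus])

lemma torus_rel_rep_abs: "torus_rel (rep_torus (abs_torus x)) x"
  by (simp add: abs_torus_eq_iff[symmetric])

lemma torus_cases_abs: obtains x where "q = abs_torus x"
  by (metis abs_rep_torus)

definition int_vec :: "(real ^ 'n::finite) set" where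
  "int_vec = {k. \<forall>i. k $ i \<in> \<int>}"

lemma torus_rel_iff_int_vec: "torus_rel x y \<longleftrightarrow> x - y \<in> int_vec"
  by (simp add: torus_rel_def int_vec_def)

lemma torus_relE:
  assumes "torus_rel x y" obtains k where "k \<in> int_vec" "x = y + k"
  using assms by (metis torus_rel_iff_int_vec add.commute diff_add_cancel)

lemma abs_torus_add_int_vec [simp]: "k \<in> int_vec \<Longrightarrow> abs_torus (x + k) = abs_torus x"
  by (simp add: abs_torus_eq_iff torus_rel_iff_int_vec)

lemma int_vec_uminus: "k \<in> int_vec \<Longrightarrow> - k \<in> int_vec"
  by (simp add: int_vec_def)

lemma continuous_on_abs_torus: "continuous_on S abs_torus"
proof -
  have "continuous_on UNIV abs_torus"
    by (simp add: continuous_on_open_vimage open_torus_def)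
  then show ?thesis
    using continuous_on_subset by blast
qed

lemma measurable_abs_torus [measurable]: "abs_torus \<in> borel_measurable borel"
  by (rule borel_measurable_continuous_onI[OF continuous_on_abs_torus])

text \<open>The preimage of the image is the union of all lattice translates of \<open>U\<close>, so
  the quotient map is open as well as continuous.\<close>

lemma open_abs_torus_image:
  assumes "open U"
  shows "open (abs_torus ` U)"
proof -
  have "abs_torus -` abs_torus ` U = (\<Union>k\<in>int_vec. (+) k ` U)"
  proof (intro equalityI subsetI)
    fix x assume "x \<in> abs_torus -` abs_torus ` U"
    then obtain u where "u \<in> U" "torus_rel x u"
      by (auto simp: abs_torus_eq_iff)
    then show "x \<in> (\<Union>k\<in>int_vec. (+) k ` U)"
      by (auto elim!: torus_relE intro!: image_eqI[where x = u] simp: add.commute)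
  next
    fix x assume "x \<in> (\<Union>k\<in>int_vec. (+) k ` U)"
    then obtain k u where "k \<in> int_vec" "u \<in> U" "x = u + k"
      by (auto simp: add.commute)
    then show "x \<in> abs_torus -` abs_torus ` U"
      by simp
  qed
  moreover have "open (\<Union>k\<in>int_vec. (+) k ` U)"
    using assms by (auto intro: open_translation)
  ultimately show ?thesis
    by (simp add: open_torus_def)
qed

text \<open>Continuity gives one inclusion of filters, openness of the quotient map the other. In
  this form the topology can be transported to products.\<close>

lemma nhds_abs_torus: "nhds (abs_torus (x :: real ^ 'a::finite)) = filtermap abs_torus (nhds x)"
proof (rule antisym)
  have "(abs_torus \<longlongrightarrow> abs_torus x) (at x)"
    using continuous_on_abs_torus[where S = UNIV and 'a = 'a] by (simp add: continuous_on_def)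
  then show "filtermap abs_torus (nhds x) \<le> nhds (abs_torus x)"
    using tendsto_at_iff_tendsto_nhds[of abs_torus x] by (simp add: filterlim_def)
next
  show "nhds (abs_torus x) \<le> filtermap abs_torus (nhds x)"
    unfolding le_filter_def eventually_filtermap
  proof (intro allI impI)
    fix Q assume "\<forall>\<^sub>F y in nhds x. Q (abs_torus y)"
    then obtain S where "open S" "x \<in> S" "\<forall>y\<in>S. Q (abs_torus y)"
      by (auto simp: eventually_nhds)
    then show "eventually Q (nhds (abs_torus x))"
      unfolding eventually_nhds
      by (intro exI[of _ "abs_torus ` S"]) (auto intro: open_abs_torus_image)
  qed
qed

lemma continuous_on_torus_iff:
  fixes f :: "'n::finite torus \<Rightarrow> 'a::topological_space"
  shows "continuous_on UNIV f \<longleftrightarrow> continuous_on UNIV (\<lambda>x. f (abs_torus x))"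
proof
  show "continuous_on UNIV f \<Longrightarrow> continuous_on UNIV (\<lambda>x. f (abs_torus x))"
    by (rule continuous_on_compose2[OF _ continuous_on_abs_torus]) auto
next
  assume "continuous_on UNIV (\<lambda>x. f (abs_torus x))"
  then show "continuous_on UNIV f"
    by (simp add: continuous_on_open_vimage open_torus_def vimage_def)
qed

lemma continuous_on_torus_abs:
  "continuous_on UNIV f \<Longrightarrow> continuous_on S (\<lambda>x. f (abs_torus x))"
  using continuous_on_torus_iff continuous_on_subset by blast

text \<open>A product of quotient maps need not be a quotient map in general. Here the neighbourhood
  filters are pushed forward in each factor, so limits can be tested on representatives.\<close>

lemma continuous_on_torus_prod:
  fixes f :: "'n::finite torus \<times> 'm::finite torus \<Rightarrow> 'a::topological_space"
  assumes "continuous_on UNIV (\<lambda>(x, y). f (abs_torus x, abs_torus y))"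
  shows "continuous_on UNIV f"
proof -
  have "(f \<longlongrightarrow> f (a, b)) (nhds (a, b))" for a b
  proof -
    obtain x y where [simp]: "a = abs_torus x" "b = abs_torus y"
      by (metis abs_rep_torus)
    have "((\<lambda>(x, y). f (abs_torus x, abs_torus y)) \<longlongrightarrow> f (abs_torus x, abs_torus y)) (nhds (x, y))"
      using assms unfolding continuous_on_def tendsto_at_iff_tendsto_nhds by force
    then show ?thesis
      by (simp add: nhds_prod nhds_abs_torus prod_filtermap1 prod_filtermap2 filterlim_filtermap case_prod_unfold split_beta)
  qed
  then show ?thesis
    unfolding continuous_on_def tendsto_at_iff_tendsto_nhds
    by (metis surj_pair)
qed

section \<open>Fundamental cube, compactness and second countability\<close>

definition fund_cube :: "(real ^ 'n::finite) set" where
  "fund_cube = {x. \<forall>i. 0 \<le> x $ i \<and> x $ i < 1}"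

lemma floor_vec_int_vec: "(\<chi> i. of_int \<lfloor>x $ i\<rfloor>) \<in> int_vec"
  by (simp add: int_vec_def)

lemma torus_in_fund_cube: obtains x where "x \<in> fund_cube" "q = abs_torus x"
proof -
  define y where "y = rep_torus q"
  define k where "k = - (\<chi> i. real_of_int \<lfloor>y $ i\<rfloor>)"
  have "k \<in> int_vec"
    unfolding k_def by (intro int_vec_uminus floor_vec_int_vec)
  then have "abs_torus (y + k) = q"
    by (simp add: y_def)
  moreover have "y + k \<in> fund_cube"
    by (auto simp: fund_cube_def k_def) linarith
  ultimately show ?thesis
    using that by blast
qed

lemma fund_cube_subset: "fund_cube \<subseteq> cbox 0 (1 :: real ^ 'n::finite)"
  by (auto simp: fund_cube_def mem_box_cart less_imp_le)

lemma abs_torus_cbox: "abs_torus ` cbox 0 1 = UNIV"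
  using fund_cube_subset by (auto intro: torus_in_fund_cube)

lemma compact_torus_UNIV: "compact (UNIV :: 'n::finite torus set)"
  using compact_continuous_image[OF continuous_on_abs_torus compact_cbox] abs_torus_cbox
  by metis

text \<open>An open continuous surjection maps a countable basis to a basis. Second countability
  identifies the Borel sets of a product with the product sigma-algebra, on which graph maps and
  Fubini rely.\<close>

instance torus :: (finite) second_countable_topology
proof
  obtain B :: "(real ^ 'a) set set" where B: "countable B" "topological_basis B"
    using ex_countable_basis by blast
  define C :: "'a torus set set" where "C = (`) abs_torus ` B"
  have "topological_basis C"
  proof (rule topological_basisI)
    fix T assume "T \<in> C"
    then show "open T"
      using B(2) by (auto simp: C_def intro!: open_abs_torus_image topological_basis_open)
  next
    fix U :: "'a torus set" and q assume U: "open U" "q \<in> U"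
    obtain x where q: "q = abs_torus x"
      by (metis abs_rep_torus)
    obtain T where "T \<in> B" "x \<in> T" "T \<subseteq> abs_torus -` U"
      using topological_basisE[OF B(2), of "abs_torus -` U" x] U by (auto simp: open_torus_def q)
    then show "\<exists>T\<in>C. q \<in> T \<and> T \<subseteq> U"
      by (auto simp: C_def q)
  qed
  moreover have "countable C"
    using B(1) by (simp add: C_def)
  ultimately show "\<exists>B::'a torus set set. countable B \<and> open = generate_topology B"
    using topological_basis_imp_subbasis by blast
qed

section \<open>Gradients and translations\<close>

lemma frechet_derivative_eqI: "(f has_derivative f') (at x) \<Longrightarrow> frechet_derivative f (at x) = f'"
  by (metis frechet_derivative_at)

text \<open>The lift of \<phi> is unchanged by a lattice translation, so the chain rule moves the
  derivative along. This frees \<open>torus_grad\<close> from the representative chosen by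
  \<open>rep_torus\<close>.\<close>

lemma GDERIV_torus_shift:
  assumes "GDERIV (\<phi> \<circ> abs_torus) x :> D" "torus_rel y x"
  shows "GDERIV (\<phi> \<circ> abs_torus) y :> D"
proof -
  obtain k where k: "k \<in> int_vec" "y = x + k"
    using assms(2) by (rule torus_relE)
  have "((\<phi> \<circ> abs_torus) \<circ> (\<lambda>z. z + - k) has_derivative (\<lambda>h. h \<bullet> D) \<circ> (\<lambda>h. h)) (at y)"
    by (rule diff_chain_at) (use assms(1) in \<open>auto simp: gderiv_def k intro!: derivative_eq_intros\<close>)
  moreover have "(\<phi> \<circ> abs_torus) \<circ> (\<lambda>z. z + - k) = \<phi> \<circ> abs_torus"
    using abs_torus_add_int_vec[OF int_vec_uminus[OF k(1)]] by (simp only: fun_eq_iff o_apply) blast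
  ultimately show ?thesis
    by (simp add: gderiv_def comp_def)
qed

lemma torus_grad_eq:
  assumes "GDERIV (\<phi> \<circ> abs_torus) x :> D"
  shows "torus_grad \<phi> (abs_torus x) = D"
  unfolding torus_grad_def
proof (rule the_equality)
  show "GDERIV (\<phi> \<circ> abs_torus) (rep_torus (abs_torus x)) :> D"
    by (rule GDERIV_torus_shift[OF assms torus_rel_rep_abs])
  then show "D' = D" if "GDERIV (\<phi> \<circ> abs_torus) (rep_torus (abs_torus x)) :> D'" for D'
  proof -
    assume "GDERIV (\<phi> \<circ> abs_torus) (rep_torus (abs_torus x)) :> D"
    then have "(\<lambda>h. h \<bullet> D) = (\<lambda>h. h \<bullet> D')"
      using that unfolding gderiv_def by (rule has_derivative_unique)
    then show ?thesis
      by (metis vector_eq_ldot)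
  qed
qed

text \<open>From here on C^1 functions are handled through a continuous gradient field on the torus
  instead of iterated partial derivatives; \<open>C1_torusD\<close> is the converse.\<close>

lemma C1_torusI:
  fixes \<phi> :: "'n::finite torus \<Rightarrow> real"
  assumes "\<And>x. GDERIV (\<phi> \<circ> abs_torus) x :> g (abs_torus x)" "continuous_on UNIV g"
  shows "C1_torus \<phi>" "torus_grad \<phi> = g"
proof -
  have "frechet_derivative (\<phi> \<circ> abs_torus) (at x) = (\<lambda>h. h \<bullet> g (abs_torus x))" for x
    using assms(1)[of x] by (intro frechet_derivative_eqI) (simp add: gderiv_def)
  moreover have "continuous_on UNIV (\<lambda>x. axis i 1 \<bullet> g (abs_torus x))" for i
    using continuous_on_torus_abs[OF assms(2)] by (intro continuous_intros)
  ultimately show "C1_torus \<phi>"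
    using assms(1) by (auto simp: C1_torus_def gderiv_def differentiable_def)
  show "torus_grad \<phi> = g"
    by (rule ext) (metis abs_rep_torus assms(1) torus_grad_eq)
qed

lemma C1_torusD:
  fixes \<phi> :: "'n::finite torus \<Rightarrow> real"
  assumes "C1_torus \<phi>"
  shows "GDERIV (\<phi> \<circ> abs_torus) x :> torus_grad \<phi> (abs_torus x)"
    and "continuous_on UNIV (torus_grad \<phi>)"
proof -
  \<comment> \<open>The candidate gradient is the vector of partial derivatives. Differentiability
    is part of \<open>Ck 1\<close>, so linearity of the Frechet derivative makes \<open>G\<close>
    the gradient.\<close>
  define G where "G x = (\<chi> i. frechet_derivative (\<phi> \<circ> abs_torus) (at x) (axis i 1))" for x
  have G: "GDERIV (\<phi> \<circ> abs_torus) x :> G x" for x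
  proof -
    let ?D = "frechet_derivative (\<phi> \<circ> abs_torus) (at x)"
    have D: "((\<phi> \<circ> abs_torus) has_derivative ?D) (at x)"
      using assms by (simp add: C1_torus_def frechet_derivative_works)
    have "?D h = h \<bullet> G x" for h
    proof -
      have "?D h = ?D (\<Sum>i\<in>UNIV. (h $ i) *\<^sub>R axis i 1)"
        using basis_expansion[of h] by (simp add: scalar_mult_eq_scaleR)
      also have "\<dots> = (\<Sum>i\<in>UNIV. h $ i * ?D (axis i 1))"
        using has_derivative_linear[OF D] by (simp add: linear_sum linear_cmul)
      finally show ?thesis
        by (simp add: inner_vec_def G_def)
    qed
    then have "?D = (\<lambda>h. h \<bullet> G x)"
      by blast
    then show ?thesis
      using D by (simp add: gderiv_def)
  qed
  have eq: "torus_grad \<phi> (abs_torus x) = G x" for x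
    by (rule torus_grad_eq[OF G])
  show "GDERIV (\<phi> \<circ> abs_torus) x :> torus_grad \<phi> (abs_torus x)"
    by (simp add: eq G)
  have "continuous_on UNIV G"
    unfolding G_def using assms by (intro continuous_intros) (simp add: C1_torus_def)
  then show "continuous_on UNIV (torus_grad \<phi>)"
    by (simp add: continuous_on_torus_iff eq)
qed

text \<open>Serves both variations used below: midpoints of two test functions, and lines
  \<open>\<phi> + t * \<theta>\<close>.\<close>

lemma C1_torus_lincomb:
  fixes \<phi> \<psi> :: "'n::finite torus \<Rightarrow> real"
  assumes "C1_torus \<phi>" "C1_torus \<psi>"
  shows "C1_torus (\<lambda>x. a * \<phi> x + b * \<psi> x)"
    and "torus_grad (\<lambda>x. a * \<phi> x + b * \<psi> x) = (\<lambda>x. a *\<^sub>R torus_grad \<phi> x + b *\<^sub>R torus_grad \<psi> x)"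
proof -
  note D = C1_torusD(1)[OF assms(1)] C1_torusD(1)[OF assms(2)]
  note cont = C1_torusD(2)[OF assms(1)] C1_torusD(2)[OF assms(2)]
  have "GDERIV ((\<lambda>x. a * \<phi> x + b * \<psi> x) \<circ> abs_torus) x :>
      a *\<^sub>R torus_grad \<phi> (abs_torus x) + b *\<^sub>R torus_grad \<psi> (abs_torus x)" for x
    using D[of x] unfolding gderiv_def comp_def
    by (auto intro!: derivative_eq_intros simp: inner_add_right)
  moreover have "continuous_on UNIV (\<lambda>q. a *\<^sub>R torus_grad \<phi> q + b *\<^sub>R torus_grad \<psi> q)"
    using cont by (intro continuous_intros)
  ultimately show "C1_torus (\<lambda>x. a * \<phi> x + b * \<psi> x)"
    "torus_grad (\<lambda>x. a * \<phi> x + b * \<psi> x) = (\<lambda>x. a *\<^sub>R torus_grad \<phi> x + b *\<^sub>R torus_grad \<psi> x)"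
    by (rule C1_torusI[where g = "\<lambda>q. a *\<^sub>R torus_grad \<phi> q + b *\<^sub>R torus_grad \<psi> q"])+
qed

lemma C1_torus_const: "C1_torus (\<lambda>_. c)"
  by (rule C1_torusI(1)[where g = "\<lambda>_. 0"]) (auto simp: comp_def GDERIV_const)

section \<open>Group structure and translations\<close>

instantiation torus :: (finite) ab_group_add
begin

lift_definition zero_torus :: "'a torus" is 0 .

lift_definition plus_torus :: "'a torus \<Rightarrow> 'a torus \<Rightarrow> 'a torus" is "(+)"
  unfolding torus_rel_def by (simp add: add_diff_add)

lift_definition uminus_torus :: "'a torus \<Rightarrow> 'a torus" is uminus
  unfolding torus_rel_def
proof (intro allI)
  fix x y :: "real ^ 'a" and i
  assume "\<forall>i. x $ i - y $ i \<in> \<int>"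
  then have "- (x $ i - y $ i) \<in> \<int>"
    by (intro Ints_minus) auto
  then show "(- x) $ i - (- y) $ i \<in> \<int>"
    by simp
qed

lift_definition minus_torus :: "'a torus \<Rightarrow> 'a torus \<Rightarrow> 'a torus" is "(-)"
  unfolding torus_rel_def
proof (intro allI)
  fix x y u v :: "real ^ 'a" and i
  assume "\<forall>i. x $ i - y $ i \<in> \<int>" "\<forall>i. u $ i - v $ i \<in> \<int>"
  then have "(x $ i - y $ i) - (u $ i - v $ i) \<in> \<int>"
    by (intro Ints_diff[of "x $ i - y $ i" "u $ i - v $ i"]) auto
  then show "(x - u) $ i - (y - v) $ i \<in> \<int>"
    by (simp add: algebra_simps)
qed

instance
  by standard (transfer; simp add: torus_rel_def)+

end

lemma continuous_on_torus_plus: "continuous_on UNIV (\<lambda>(x, y :: 'n::finite torus). x + y)"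
proof (rule continuous_on_torus_prod)
  have "continuous_on UNIV (\<lambda>z :: (real ^ 'n) \<times> (real ^ 'n). abs_torus (fst z + snd z))"
    by (rule continuous_on_compose2[OF continuous_on_abs_torus]) (auto intro!: continuous_intros)
  then show "continuous_on UNIV (\<lambda>(x :: real ^ 'n, y). case (abs_torus x, abs_torus y) of (x, y) \<Rightarrow> x + y)"
    by (simp add: plus_torus.abs_eq case_prod_unfold)
qed

lemma continuous_on_torus_minus: "continuous_on UNIV (\<lambda>(x, y :: 'n::finite torus). x - y)"
proof (rule continuous_on_torus_prod)
  have "continuous_on UNIV (\<lambda>z :: (real ^ 'n) \<times> (real ^ 'n). abs_torus (fst z - snd z))"
    by (rule continuous_on_compose2[OF continuous_on_abs_torus]) (auto intro!: continuous_intros)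
  then show "continuous_on UNIV (\<lambda>(x :: real ^ 'n, y). case (abs_torus x, abs_torus y) of (x, y) \<Rightarrow> x - y)"
    by (simp add: minus_torus.abs_eq case_prod_unfold)
qed

lemma continuous_on_torus_plus_const:
  assumes "continuous_on UNIV f"
  shows "continuous_on UNIV (\<lambda>x :: 'n::finite torus. f (x + a))"
proof -
  have "continuous_on UNIV (\<lambda>x. (\<lambda>(x, y). x + y) (x, a))"
    by (rule continuous_on_compose2[OF continuous_on_torus_plus]) (auto intro!: continuous_on_Pair continuous_on_id continuous_on_const)
  then show ?thesis
    using continuous_on_compose2[OF assms] by fastforce
qed

text \<open>Translates of test functions are again test functions; this is what lets energies be
  averaged over translations when \<mu> is convolved.\<close>

lemma C1_torus_translate:
  fixes \<phi> :: "'n::finite torus \<Rightarrow> real"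
  assumes "C1_torus \<phi>"
  shows "C1_torus (\<lambda>x. \<phi> (x + a))" and "torus_grad (\<lambda>x. \<phi> (x + a)) = (\<lambda>x. torus_grad \<phi> (x + a))"
proof -
  obtain z where a: "a = abs_torus z"
    by (rule torus_cases_abs)
  have "GDERIV ((\<lambda>x. \<phi> (x + a)) \<circ> abs_torus) x :> torus_grad \<phi> (abs_torus x + a)" for x
  proof -
    have "(((\<phi> \<circ> abs_torus) \<circ> (\<lambda>x. x + z)) has_derivative
        (\<lambda>h. h \<bullet> torus_grad \<phi> (abs_torus (x + z))) \<circ> (\<lambda>h. h)) (at x)"
      by (rule diff_chain_at)
        (use C1_torusD(1)[OF assms, of "x + z"] in \<open>auto simp: gderiv_def intro!: derivative_eq_intros\<close>)
    then show ?thesis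
      by (simp add: gderiv_def a comp_def plus_torus.abs_eq)
  qed
  note C1_torusI[where g = "\<lambda>q. torus_grad \<phi> (q + a)", OF this]
  moreover have "continuous_on UNIV (\<lambda>x. torus_grad \<phi> (x + a))"
    by (rule continuous_on_torus_plus_const[OF C1_torusD(2)[OF assms]])
  ultimately show "C1_torus (\<lambda>x. \<phi> (x + a))"
    "torus_grad (\<lambda>x. \<phi> (x + a)) = (\<lambda>x. torus_grad \<phi> (x + a))"
    by auto
qed

section \<open>Energy and action\<close>

text \<open>\<open>F \<mu> P\<close> is half the infimum of this quantity over C^1 functions, hence
  the recurring \<open>2 * F \<mu> P\<close>.\<close>

definition energy :: "'n::finite torus measure \<Rightarrow> real ^ 'n \<Rightarrow> ('n torus \<Rightarrow> real) \<Rightarrow> real" where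
  "energy \<mu> P \<phi> = (\<integral>x. (norm (torus_grad \<phi> x + P))\<^sup>2 \<partial>\<mu>)"

definition action :: "real ^ 'n \<Rightarrow> ('n::finite torus \<times> (real ^ 'n)) measure \<Rightarrow> real" where
  "action P \<xi> = (\<integral>(x, p). (norm p)\<^sup>2 / 2 - p \<bullet> P \<partial>\<xi>)"

lemma borel_probsD:
  assumes "\<mu> \<in> borel_probs"
  shows "prob_space \<mu>" "sets \<mu> = sets borel" "space \<mu> = UNIV"
  using assms sets_eq_imp_space_eq[of \<mu> borel] by (auto simp: borel_probs_def)

lemma continuous_torus_bounded:
  fixes f :: "'n::finite torus \<Rightarrow> 'b::real_normed_vector"
  assumes "continuous_on UNIV f"
  obtains B where "0 < B" "\<And>x. norm (f x) \<le> B"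
proof -
  have "bounded (range f)"
    using compact_continuous_image[OF assms compact_torus_UNIV] compact_imp_bounded by blast
  then show ?thesis
    using that by (auto simp: bounded_pos)
qed

lemma measurable_continuous_borel_probs:
  assumes "\<mu> \<in> borel_probs" "continuous_on UNIV f"
  shows "f \<in> borel_measurable \<mu>"
  using borel_measurable_continuous_onI[OF assms(2)] borel_probsD(2)[OF assms(1)]
  by (simp cong: measurable_cong_sets)

lemma integrable_continuous_torus:
  fixes f :: "'n::finite torus \<Rightarrow> 'b::{banach, second_countable_topology}"
  assumes "\<mu> \<in> borel_probs" "continuous_on UNIV f"
  shows "integrable \<mu> f"
proof -
  interpret prob_space \<mu> by (rule borel_probsD(1)[OF assms(1)])
  obtain B where "\<And>x. norm (f x) \<le> B"
    using continuous_torus_bounded[OF assms(2)] by metis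
  then show ?thesis
    by (intro integrable_const_bound[of _ B] measurable_continuous_borel_probs assms) auto
qed

lemma LamD:
  assumes "\<xi> \<in> Lam \<mu>"
  shows "\<xi> \<in> borel_probs" "distr \<xi> borel fst = \<mu>" "integrable \<xi> (\<lambda>z. (norm (snd z))\<^sup>2)"
    "C1_torus \<theta> \<Longrightarrow> (\<integral>z. snd z \<bullet> torus_grad \<theta> (fst z) \<partial>\<xi>) = 0"
  using assms by (auto simp: Lam_def case_prod_unfold)

lemma Lam_integral_fst:
  fixes f :: "'n::finite torus \<Rightarrow> real"
  assumes "\<xi> \<in> Lam \<mu>" "continuous_on UNIV f"
  shows "integrable \<xi> (\<lambda>z. f (fst z))" "(\<integral>z. f (fst z) \<partial>\<xi>) = (\<integral>x. f x \<partial>\<mu>)"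
proof -
  note \<xi> = LamD[OF assms(1)]
  interpret prob_space \<xi> by (rule borel_probsD(1)[OF \<xi>(1)])
  have [measurable]: "fst \<in> borel_measurable \<xi>"
    by (rule measurable_continuous_borel_probs[OF \<xi>(1) continuous_on_fst[OF continuous_on_id]])
  have [measurable]: "f \<in> borel_measurable borel"
    by (rule borel_measurable_continuous_onI[OF assms(2)])
  show "(\<integral>z. f (fst z) \<partial>\<xi>) = (\<integral>x. f x \<partial>\<mu>)"
    by (subst \<xi>(2)[symmetric], subst integral_distr) auto
  obtain B where "\<And>x. norm (f x) \<le> B"
    using continuous_torus_bounded[OF assms(2)] by metis
  then show "integrable \<xi> (\<lambda>z. f (fst z))"
    by (intro integrable_const_bound[of _ B]) auto
qed

text \<open>\<open>h\<close> is bounded by compactness, and \<open>norm p\<close> is at most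
  \<open>1 + (norm p)\<^sup>2\<close>, which is integrable.\<close>

lemma Lam_integrable_inner:
  fixes h :: "'n::finite torus \<Rightarrow> real ^ 'n"
  assumes "\<xi> \<in> Lam \<mu>" "continuous_on UNIV h"
  shows "integrable \<xi> (\<lambda>z. snd z \<bullet> h (fst z))"
proof -
  note \<xi> = LamD[OF assms(1)]
  interpret prob_space \<xi> by (rule borel_probsD(1)[OF \<xi>(1)])
  obtain B where B: "0 < B" "\<And>x. norm (h x) \<le> B"
    using continuous_torus_bounded[OF assms(2)] by metis
  have "integrable \<xi> (\<lambda>z. B * (1 + (norm (snd z))\<^sup>2))"
    using \<xi>(3) by auto
  then show ?thesis
  proof (rule Bochner_Integration.integrable_bound)
    show "(\<lambda>z. snd z \<bullet> h (fst z)) \<in> borel_measurable \<xi>"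
      by (rule measurable_continuous_borel_probs[OF \<xi>(1)])
        (intro continuous_intros continuous_on_compose2[OF assms(2)], auto)
    have "norm (snd z \<bullet> h (fst z)) \<le> norm (B * (1 + (norm (snd z))\<^sup>2))" for z
    proof -
      have "norm (snd z) \<le> 1 + (norm (snd z))\<^sup>2"
        using sum_squares_bound[of "norm (snd z)" 1] by (simp add: power2_eq_square) (smt (verit) mult_nonneg_nonneg norm_ge_zero)
      then have "norm (snd z) * norm (h (fst z)) \<le> (1 + (norm (snd z))\<^sup>2) * B"
        using B by (intro mult_mono) auto
      then show ?thesis
        using Cauchy_Schwarz_ineq2[of "snd z" "h (fst z)"] B(1) by (simp add: mult.commute)
    qed
    then show "AE z in \<xi>. norm (snd z \<bullet> h (fst z)) \<le> norm (B * (1 + (norm (snd z))\<^sup>2))"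
      by simp
  qed
qed

lemma continuous_on_energy_density:
  assumes "C1_torus \<phi>"
  shows "continuous_on UNIV (\<lambda>x. torus_grad \<phi> x + P)"
    and "continuous_on UNIV (\<lambda>x. (norm (torus_grad \<phi> x + P))\<^sup>2)"
  using C1_torusD(2)[OF assms] by (auto intro!: continuous_intros)

text \<open>After expanding the square, the term \<open>p \<bullet> \<nabla>\<phi>\<close>
  integrates to zero because \<xi> is divergence free, and the term depending on \<open>x\<close>
  alone integrates to the energy because \<mu> is the marginal.\<close>

lemma Lam_dist_gradient:
  assumes "\<xi> \<in> Lam \<mu>" "C1_torus \<phi>"
  shows "integrable \<xi> (\<lambda>z. (norm (snd z - (torus_grad \<phi> (fst z) + P)))\<^sup>2)" (is ?I)
    and "(\<integral>z. (norm (snd z - (torus_grad \<phi> (fst z) + P)))\<^sup>2 \<partial>\<xi>) = 2 * action P \<xi> + energy \<mu> P \<phi>" (is ?E)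
proof -
  note \<xi> = LamD[OF assms(1)]
  let ?d = "\<lambda>z. (norm (torus_grad \<phi> (fst z) + P))\<^sup>2"
  define a where "a z = (norm (snd z))\<^sup>2 / 2 - snd z \<bullet> P" for z :: "'a torus \<times> (real ^ 'a)"
  have i1: "integrable \<xi> a"
    using \<xi>(3) Lam_integrable_inner[OF assms(1), of "\<lambda>_. P"] unfolding a_def by auto
  have i2: "integrable \<xi> (\<lambda>z. snd z \<bullet> torus_grad \<phi> (fst z))"
    by (rule Lam_integrable_inner[OF assms(1) C1_torusD(2)[OF assms(2)]])
  have i3: "integrable \<xi> ?d"
    by (rule Lam_integral_fst[OF assms(1) continuous_on_energy_density(2)[OF assms(2)]])
  have eq: "(norm (snd z - (torus_grad \<phi> (fst z) + P)))\<^sup>2 =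
      2 * a z - 2 * (snd z \<bullet> torus_grad \<phi> (fst z)) + ?d z" for z
    by (simp add: a_def power2_norm_eq_inner algebra_simps inner_commute)
  show ?I
    unfolding eq by (intro Bochner_Integration.integrable_add Bochner_Integration.integrable_diff
        integrable_mult_right i1 i2 i3)
  have "(\<integral>z. ?d z \<partial>\<xi>) = energy \<mu> P \<phi>"
    unfolding energy_def
    by (rule Lam_integral_fst[OF assms(1) continuous_on_energy_density(2)[OF assms(2)]])
  then show ?E
    unfolding eq using i1 i2 i3 \<xi>(4)[OF assms(2)] by (simp add: action_def case_prod_unfold a_def[symmetric])
qed

lemma energy_nonneg: "0 \<le> energy \<mu> P \<phi>"
  unfolding energy_def by simp

text \<open>A real-valued \<open>INF\<close> is a lower bound only if the set is bounded below; here
  zero is a bound.\<close>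

lemma F_le_energy: "C1_torus \<phi> \<Longrightarrow> 2 * F \<mu> P \<le> energy \<mu> P \<phi>"
  unfolding F_def energy_def[symmetric]
  using cINF_lower[of "energy \<mu> P" "Collect C1_torus" \<phi>] bdd_belowI2[of "Collect C1_torus" 0 "energy \<mu> P"]
  by (auto simp: energy_nonneg)

lemma F_greatest:
  assumes "\<And>\<phi>. C1_torus \<phi> \<Longrightarrow> c \<le> energy \<mu> P \<phi>"
  shows "c \<le> 2 * F \<mu> P"
  unfolding F_def energy_def[symmetric]
  using cINF_greatest[of "Collect C1_torus" c "energy \<mu> P"] assms C1_torus_const by auto

lemma F_approx:
  assumes "0 < e"
  obtains \<phi> where "C1_torus \<phi>" "energy \<mu> P \<phi> < 2 * F \<mu> P + e"
  using F_greatest[of "2 * F \<mu> P + e" \<mu> P] assms by fastforce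

text \<open>The easy half of a duality: the integrated square in \<open>Lam_dist_gradient\<close> is
  nonnegative for every test function.\<close>

lemma action_ge:
  assumes "\<xi> \<in> Lam \<mu>"
  shows "- F \<mu> P \<le> action P \<xi>"
proof -
  have "- 2 * action P \<xi> \<le> energy \<mu> P \<phi>" if "C1_torus \<phi>" for \<phi>
  proof -
    have "0 \<le> 2 * action P \<xi> + energy \<mu> P \<phi>"
      by (subst Lam_dist_gradient(2)[OF assms that, symmetric]) simp
    then show ?thesis by simp
  qed
  from F_greatest[OF this] show ?thesis by simp
qed

text \<open>The coefficient linear in \<open>t\<close> is the first variation. Its vanishing in the
  limit of a minimising sequence is the divergence condition for the limit field.\<close>

lemma energy_expand:
  assumes "\<mu> \<in> borel_probs" "C1_torus \<phi>" "C1_torus \<theta>"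
  shows "energy \<mu> P (\<lambda>x. 1 * \<phi> x + t * \<theta> x) = energy \<mu> P \<phi>
    + 2 * t * (\<integral>x. (torus_grad \<phi> x + P) \<bullet> torus_grad \<theta> x \<partial>\<mu>)
    + t\<^sup>2 * (\<integral>x. (norm (torus_grad \<theta> x))\<^sup>2 \<partial>\<mu>)"
proof -
  note int = integrable_continuous_torus[OF assms(1)]
  note cont = C1_torusD(2)[OF assms(2)] C1_torusD(2)[OF assms(3)]
  have eq: "(norm (1 *\<^sub>R torus_grad \<phi> x + t *\<^sub>R torus_grad \<theta> x + P))\<^sup>2 = (norm (torus_grad \<phi> x + P))\<^sup>2
      + 2 * t * ((torus_grad \<phi> x + P) \<bullet> torus_grad \<theta> x) + t\<^sup>2 * (norm (torus_grad \<theta> x))\<^sup>2" for x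
    by (simp only: power2_norm_eq_inner)
      (simp add: algebra_simps inner_commute power2_eq_square)
  have "integrable \<mu> (\<lambda>x. (norm (torus_grad \<phi> x + P))\<^sup>2)"
    "integrable \<mu> (\<lambda>x. (torus_grad \<phi> x + P) \<bullet> torus_grad \<theta> x)"
    "integrable \<mu> (\<lambda>x. (norm (torus_grad \<theta> x))\<^sup>2)"
    by (intro int continuous_intros cont)+
  then show ?thesis
    unfolding energy_def C1_torus_lincomb(2)[OF assms(2,3)] eq by simp
qed

text \<open>The midpoint of two test functions is admissible, so its energy is at least
  \<open>2 * F \<mu> P\<close>; the parallelogram identity then makes near-minimisers close in
  L^2.\<close>

lemma energy_parallelogram:
  assumes "\<mu> \<in> borel_probs" "C1_torus \<phi>" "C1_torus \<psi>"
  shows "(\<integral>x. (norm (torus_grad \<phi> x - torus_grad \<psi> x))\<^sup>2 \<partial>\<mu>)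
    \<le> 2 * (energy \<mu> P \<phi> - 2 * F \<mu> P) + 2 * (energy \<mu> P \<psi> - 2 * F \<mu> P)"
proof -
  note int = integrable_continuous_torus[OF assms(1)]
  note cont = C1_torusD(2)[OF assms(2)] C1_torusD(2)[OF assms(3)]
  let ?h = "\<lambda>x. (1/2) *\<^sub>R torus_grad \<phi> x + (1/2) *\<^sub>R torus_grad \<psi> x + P"
  have "2 * F \<mu> P \<le> energy \<mu> P (\<lambda>x. (1/2) * \<phi> x + (1/2) * \<psi> x)"
    by (rule F_le_energy[OF C1_torus_lincomb(1)[OF assms(2,3)]])
  then have half: "2 * F \<mu> P \<le> (\<integral>x. (norm (?h x))\<^sup>2 \<partial>\<mu>)"
    unfolding energy_def C1_torus_lincomb(2)[OF assms(2,3)] .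
  have eq: "(norm (torus_grad \<phi> x - torus_grad \<psi> x))\<^sup>2 =
      2 * (norm (torus_grad \<phi> x + P))\<^sup>2 + 2 * (norm (torus_grad \<psi> x + P))\<^sup>2 - 4 * (norm (?h x))\<^sup>2" for x
    by (simp only: power2_norm_eq_inner) (simp add: algebra_simps inner_commute)
  have "integrable \<mu> (\<lambda>x. (norm (torus_grad \<phi> x + P))\<^sup>2)"
    "integrable \<mu> (\<lambda>x. (norm (torus_grad \<psi> x + P))\<^sup>2)"
    "integrable \<mu> (\<lambda>x. (norm (?h x))\<^sup>2)"
    by (intro int continuous_intros cont)+
  then have "(\<integral>x. (norm (torus_grad \<phi> x - torus_grad \<psi> x))\<^sup>2 \<partial>\<mu>) =
      2 * energy \<mu> P \<phi> + 2 * energy \<mu> P \<psi> - 4 * (\<integral>x. (norm (?h x))\<^sup>2 \<partial>\<mu>)"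
    unfolding eq energy_def by simp
  then show ?thesis
    using half by simp
qed

section \<open>L^2 estimates and limits\<close>

lemma norm_le_weighted:
  fixes u :: real
  assumes "0 < c"
  shows "u \<le> c / 2 + u\<^sup>2 / (2 * c)"
proof -
  have "0 \<le> (u - c)\<^sup>2"
    by simp
  then have "2 * c * u \<le> c\<^sup>2 + u\<^sup>2"
    by (simp add: power2_eq_square algebra_simps)
  then show ?thesis
    using assms by (simp add: field_simps power2_eq_square)
qed

text \<open>A weighted inequality in place of Cauchy-Schwarz: an L^2 bound of squared size
  \<open>c\<^sup>2\<close> gives an L^1 bound linear in \<open>c\<close>.\<close>

lemma (in prob_space) integral_norm_le_sqrt:
  fixes g :: "'a \<Rightarrow> 'b::{banach, second_countable_topology}"
  assumes "integrable M (\<lambda>x. (norm (g x))\<^sup>2)" "g \<in> borel_measurable M"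
    and "(\<integral>x. (norm (g x))\<^sup>2 \<partial>M) \<le> C * c\<^sup>2" "0 < c"
  shows "integrable M g" "(\<integral>x. norm (g x) \<partial>M) \<le> (1 + C) / 2 * c"
proof -
  have i: "integrable M (\<lambda>x. c / 2 + (norm (g x))\<^sup>2 / (2 * c))"
    using assms(1) by auto
  have le: "norm (g x) \<le> c / 2 + (norm (g x))\<^sup>2 / (2 * c)" for x
    by (rule norm_le_weighted[OF assms(4)])
  show ig: "integrable M g"
    by (rule Bochner_Integration.integrable_bound[OF i assms(2)])
      (use le order_trans[OF le abs_ge_self] in auto)
  have "(\<integral>x. norm (g x) \<partial>M) \<le> (\<integral>x. c / 2 + (norm (g x))\<^sup>2 / (2 * c) \<partial>M)"
    using ig i le by (intro integral_mono) auto
  also have "\<dots> = c / 2 + (\<integral>x. (norm (g x))\<^sup>2 \<partial>M) / (2 * c)"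
    using assms(1) by (simp add: prob_space)
  also have "\<dots> \<le> c / 2 + (C * c\<^sup>2) / (2 * c)"
    using assms(3,4) by (intro add_left_mono divide_right_mono) auto
  also have "\<dots> = (1 + C) / 2 * c"
    using assms(4) by (simp add: field_simps power2_eq_square)
  finally show "(\<integral>x. norm (g x) \<partial>M) \<le> (1 + C) / 2 * c" .
qed

text \<open>Geometric decay makes the increments summable in L^1, hence the sequence converges
  almost everywhere without passing to a subsequence; Fatou then carries the L^2 bounds to the
  limit.\<close>

lemma (in prob_space) L2_rapid_limit:
  fixes W :: "nat \<Rightarrow> 'a \<Rightarrow> 'b::euclidean_space"
  assumes [measurable]: "\<And>k. W k \<in> borel_measurable M"
    and int: "\<And>k m. integrable M (\<lambda>x. (norm (W k x - W m x))\<^sup>2)"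
    and le: "\<And>k m. k \<le> m \<Longrightarrow> (\<integral>x. (norm (W m x - W k x))\<^sup>2 \<partial>M) \<le> 4 * ((1/2) ^ k)\<^sup>2"
  obtains V where "V \<in> borel_measurable M"
    "\<And>k. integrable M (\<lambda>x. (norm (V x - W k x))\<^sup>2)"
    "\<And>k. (\<integral>x. (norm (V x - W k x))\<^sup>2 \<partial>M) \<le> 4 * ((1/2) ^ k)\<^sup>2"
proof
  \<comment> \<open>Where the sequence diverges, \<open>lim\<close> takes a fixed default value.
    This keeps \<open>V\<close> measurable, and the divergence set turns out to be null.\<close>
  define V where "V x = lim (\<lambda>k. W k x)" for x
  show V[measurable]: "V \<in> borel_measurable M"
    unfolding V_def by (rule borel_measurable_lim_metric) simp
  \<comment> \<open>The factor 5/2 is \<open>(1 + C) / 2\<close> with \<open>C = 4\<close>.\<close>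
  have L1: "integrable M (\<lambda>x. norm (W (Suc k) x - W k x))"
    "(\<integral>x. norm (W (Suc k) x - W k x) \<partial>M) \<le> 5/2 * (1/2) ^ k" for k
  proof -
    have "(\<lambda>x. W (Suc k) x - W k x) \<in> borel_measurable M" "k \<le> Suc k" "(0::real) < (1/2) ^ k"
      by simp_all
    note * = integral_norm_le_sqrt[OF int this(1) le[OF this(2)] this(3)]
    from *(1) show "integrable M (\<lambda>x. norm (W (Suc k) x - W k x))"
      by (rule integrable_norm)
    from *(2) show "(\<integral>x. norm (W (Suc k) x - W k x) \<partial>M) \<le> 5/2 * (1/2) ^ k"
      by simp
  qed
  \<comment> \<open>The sum of the increments has finite integral, so it is finite for almost every
    \<open>x\<close>.\<close>
  have "(\<integral>\<^sup>+x. (\<Sum>k. ennreal (norm (W (Suc k) x - W k x))) \<partial>M) =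
      (\<Sum>k. \<integral>\<^sup>+x. ennreal (norm (W (Suc k) x - W k x)) \<partial>M)"
    by (rule nn_integral_suminf) simp
  also have "\<dots> = (\<Sum>k. ennreal (\<integral>x. norm (W (Suc k) x - W k x) \<partial>M))"
    using L1(1) by (simp add: nn_integral_eq_integral)
  also have "\<dots> \<le> (\<Sum>k. ennreal (5/2 * (1/2) ^ k))"
    by (intro suminf_le ennreal_leI L1 summableI)
  also have "\<dots> < \<infinity>"
  proof -
    have "summable (\<lambda>k. 5/2 * (1/2) ^ k :: real)"
      by (intro summable_mult summable_geometric) simp
    then show ?thesis
      by (subst suminf_ennreal2) simp_all
  qed
  finally have "AE x in M. (\<Sum>k. ennreal (norm (W (Suc k) x - W k x))) \<noteq> \<infinity>"
    by (intro nn_integral_PInf_AE) auto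
  then have lim: "AE x in M. (\<lambda>k. W k x) \<longlonglongrightarrow> V x"
  proof eventually_elim
    case (elim x)
    then have "summable (\<lambda>k. norm (W (Suc k) x - W k x))"
      by (intro summable_suminf_not_top) auto
    then have "convergent (\<lambda>n. \<Sum>k<n. W (Suc k) x - W k x)"
      by (metis summable_norm_cancel summable_iff_convergent)
    then have "convergent (\<lambda>n. W n x - W 0 x)"
      by (simp add: sum_lessThan_telescope[of "\<lambda>k. W k x"])
    then have "convergent (\<lambda>n. (W n x - W 0 x) + W 0 x)"
      by (intro convergent_add convergent_const)
    then show ?case
      by (simp add: V_def convergent_LIMSEQ_iff)
  qed
  have nn: "(\<integral>\<^sup>+x. ennreal ((norm (V x - W k x))\<^sup>2) \<partial>M) \<le> ennreal (4 * ((1/2) ^ k)\<^sup>2)" for k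
  proof -
    \<comment> \<open>Fatou in \<open>m\<close> for fixed \<open>k\<close>.\<close>
    have "(\<integral>\<^sup>+x. ennreal ((norm (V x - W k x))\<^sup>2) \<partial>M) \<le>
        (\<integral>\<^sup>+x. liminf (\<lambda>m. ennreal ((norm (W m x - W k x))\<^sup>2)) \<partial>M)"
    proof (rule nn_integral_mono_AE, use lim in eventually_elim)
      case (elim x)
      then have "(\<lambda>m. ennreal ((norm (W m x - W k x))\<^sup>2)) \<longlonglongrightarrow> ennreal ((norm (V x - W k x))\<^sup>2)"
        by (intro tendsto_intros)
      from lim_imp_Liminf[OF _ this] show ?case
        by simp
    qed
    also have "\<dots> \<le> liminf (\<lambda>m. \<integral>\<^sup>+x. ennreal ((norm (W m x - W k x))\<^sup>2) \<partial>M)"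
      by (rule nn_integral_liminf) simp
    also have "\<dots> \<le> limsup (\<lambda>m. \<integral>\<^sup>+x. ennreal ((norm (W m x - W k x))\<^sup>2) \<partial>M)"
      by (rule Liminf_le_Limsup) simp
    also have "\<dots> \<le> ennreal (4 * ((1/2) ^ k)\<^sup>2)"
    proof (rule Limsup_bounded)
      show "\<forall>\<^sub>F m in sequentially. (\<integral>\<^sup>+x. ennreal ((norm (W m x - W k x))\<^sup>2) \<partial>M) \<le> ennreal (4 * ((1/2) ^ k)\<^sup>2)"
        using eventually_ge_at_top[of k]
        by eventually_elim (auto simp: nn_integral_eq_integral[OF int] intro!: ennreal_leI le)
    qed
    finally show ?thesis .
  qed
  show I: "integrable M (\<lambda>x. (norm (V x - W k x))\<^sup>2)" for k
    by (rule integrableI_bounded) (use nn[of k] in \<open>auto simp: le_less_trans\<close>)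
  show "(\<integral>x. (norm (V x - W k x))\<^sup>2 \<partial>M) \<le> 4 * ((1/2) ^ k)\<^sup>2" for k
    using nn[of k] by (subst (asm) nn_integral_eq_integral[OF I]) auto
qed

lemma linear_term_eq_0:
  fixes a b :: real
  assumes "\<And>t. 0 \<le> 2 * t * a + t\<^sup>2 * b" "0 \<le> b"
  shows "a = 0"
proof (rule ccontr)
  assume "a \<noteq> 0"
  \<comment> \<open>A convenient choice of \<open>t\<close> that makes the quadratic negative; the 1
    in the denominator covers \<open>b = 0\<close>.\<close>
  have "2 * (- a / (b + 1)) * a + (- a / (b + 1))\<^sup>2 * b = - (a\<^sup>2 * (b + 2)) / (b + 1)\<^sup>2"
    using assms(2) by (simp add: field_simps power2_eq_square add_nonneg_eq_0_iff)
  also have "\<dots> < 0"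
    using assms(2) \<open>a \<noteq> 0\<close> by (intro divide_neg_pos) (auto intro!: mult_pos_pos)
  finally show False
    using assms(1)[of "- a / (b + 1)"] by simp
qed

section \<open>Existence of the minimiser\<close>

lemma Lam_exists_optimal:
  assumes "\<mu> \<in> borel_probs"
  obtains \<nu> where "\<nu> \<in> Lam \<mu>" "action P \<nu> = - F \<mu> P"
proof -
  interpret prob_space \<mu> by (rule borel_probsD(1)[OF assms])
  note [measurable_cong] = borel_probsD(2)[OF assms]
  \<comment> \<open>The tolerance is a square so that the gradients are Cauchy in L^2 at a geometric
    rate.\<close>
  have "\<exists>\<phi>. C1_torus \<phi> \<and> energy \<mu> P \<phi> < 2 * F \<mu> P + ((1/2) ^ k)\<^sup>2" for k :: nat
    using F_approx[of "((1/2) ^ k)\<^sup>2"] by (metis zero_less_power zero_less_divide_1_iff zero_less_numeral)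
  then obtain \<phi> where C1: "\<And>k :: nat. C1_torus (\<phi> k)"
    and min: "\<And>k. energy \<mu> P (\<phi> k) < 2 * F \<mu> P + ((1/2) ^ k)\<^sup>2"
    by metis
  define W where "W k x = torus_grad (\<phi> k) x + P" for k x
  have contW: "continuous_on UNIV (W k)" for k
    unfolding W_def by (rule continuous_on_energy_density(1)[OF C1])
  have Wm[measurable]: "W k \<in> borel_measurable borel" for k
    by (rule borel_measurable_continuous_onI[OF contW])
  have W1: "W k \<in> borel_measurable \<mu>" for k
      by simp
  have W2: "integrable \<mu> (\<lambda>x. (norm (W k x - W m x))\<^sup>2)" for k m
      by (intro integrable_continuous_torus[OF assms] continuous_intros contW)
  have W3: "(\<integral>x. (norm (W m x - W k x))\<^sup>2 \<partial>\<mu>) \<le> 4 * ((1/2) ^ k)\<^sup>2" if "k \<le> m" for k m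
    proof -
      have "((1/2) ^ m)\<^sup>2 \<le> ((1/2 :: real) ^ k)\<^sup>2"
        using that by (intro power_mono power_decreasing) auto
      \<comment> \<open>Both excess energies are at most the tolerance of index \<open>k\<close>,
        and the parallelogram estimate doubles each: this gives the factor 4.\<close>
      moreover have "b \<le> a \<Longrightarrow> i \<le> 2 * (e - f) + 2 * (e' - f) \<Longrightarrow> e' < f + a \<Longrightarrow> e < f + b \<Longrightarrow> i \<le> 4 * a"
        for a b i e e' f :: real
        by argo
      ultimately have "(\<integral>x. (norm (torus_grad (\<phi> m) x - torus_grad (\<phi> k) x))\<^sup>2 \<partial>\<mu>) \<le> 4 * ((1/2) ^ k)\<^sup>2"
        using energy_parallelogram[OF assms C1[of m] C1[of k], of P] min[of k] min[of m] by blast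
      then show ?thesis
        by (simp only: W_def add_diff_cancel_right)
    qed
  obtain V where V: "V \<in> borel_measurable \<mu>"
    "\<And>k. integrable \<mu> (\<lambda>x. (norm (V x - W k x))\<^sup>2)"
    "\<And>k. (\<integral>x. (norm (V x - W k x))\<^sup>2 \<partial>\<mu>) \<le> 4 * ((1/2) ^ k)\<^sup>2"
    using L2_rapid_limit[OF W1 W2 W3] by blast
  have L1: "integrable \<mu> (\<lambda>x. V x - W k x)" "(\<integral>x. norm (V x - W k x) \<partial>\<mu>) \<le> (1 + 4) / 2 * (1/2) ^ k" for k
    by (rule integral_norm_le_sqrt[OF V(2) _ V(3)]; use V(1) in simp)+
  have V_int: "integrable \<mu> (\<lambda>x. (norm (V x))\<^sup>2)"
  proof (rule Bochner_Integration.integrable_bound)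
    show "integrable \<mu> (\<lambda>x. 2 * (norm (V x - W 0 x))\<^sup>2 + 2 * (norm (W 0 x))\<^sup>2)"
      by (intro Bochner_Integration.integrable_add integrable_mult_right V(2)
          integrable_continuous_torus[OF assms] continuous_intros contW)
    have "(norm (V x))\<^sup>2 \<le> 2 * (norm (V x - W 0 x))\<^sup>2 + 2 * (norm (W 0 x))\<^sup>2" for x
    proof -
      have "norm (V x) \<le> norm (V x - W 0 x) + norm (W 0 x)"
        by norm
      then have "(norm (V x))\<^sup>2 \<le> (norm (V x - W 0 x) + norm (W 0 x))\<^sup>2"
        by (intro power_mono) auto
      also have "\<dots> \<le> 2 * (norm (V x - W 0 x))\<^sup>2 + 2 * (norm (W 0 x))\<^sup>2"
        using sum_squares_bound[of "norm (V x - W 0 x)" "norm (W 0 x)"]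
        by (simp add: power2_sum)
      finally show ?thesis .
    qed
    then show "AE x in \<mu>. norm ((norm (V x))\<^sup>2) \<le> norm (2 * (norm (V x - W 0 x))\<^sup>2 + 2 * (norm (W 0 x))\<^sup>2)"
      by simp
  qed (use V(1) in measurable)
  define \<nu> where "\<nu> = distr \<mu> borel (\<lambda>x. (x, V x))"
  have V'[measurable]: "V \<in> borel_measurable borel"
    using V(1) by simp
  have graph: "(\<lambda>x. (x, V x)) \<in> measurable \<mu> borel"
    by (intro borel_measurable_Pair) (use V(1) in simp_all)
  have [measurable]: "fst \<in> borel_measurable (borel :: ('a torus \<times> (real ^ 'a)) measure)"
    by (intro borel_measurable_continuous_onI continuous_intros)
  \<comment> \<open>Euler-Lagrange equation for the limit: near-minimality bounds a quadratic in
    \<open>t\<close> below by minus the tolerance. For fixed \<open>t\<close> let \<open>k\<close>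
    tend to infinity; the resulting quadratic is nonnegative, so its linear coefficient
    vanishes.\<close>
  have divfree: "(\<integral>x. V x \<bullet> torus_grad \<theta> x \<partial>\<mu>) = 0" if \<theta>: "C1_torus \<theta>" for \<theta>
  proof (rule linear_term_eq_0)
    note cont\<theta> = C1_torusD(2)[OF \<theta>]
    have th_m[measurable]: "torus_grad \<theta> \<in> borel_measurable borel"
      by (rule borel_measurable_continuous_onI[OF cont\<theta>])
    define a where "a k = (\<integral>x. W k x \<bullet> torus_grad \<theta> x \<partial>\<mu>)" for k
    define b where "b = (\<integral>x. (norm (torus_grad \<theta> x))\<^sup>2 \<partial>\<mu>)"
    show "0 \<le> b"
      unfolding b_def by simp
    obtain C where C: "0 < C" "\<And>x. norm (torus_grad \<theta> x) \<le> C"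
      using continuous_torus_bounded[OF cont\<theta>] by metis
    have i1: "integrable \<mu> (\<lambda>x. W k x \<bullet> torus_grad \<theta> x)" for k
      by (intro integrable_continuous_torus[OF assms] continuous_intros contW cont\<theta>)
    have bnd: "norm ((V x - W k x) \<bullet> torus_grad \<theta> x) \<le> C * norm (V x - W k x)" for x k
    proof -
      have "norm ((V x - W k x) \<bullet> torus_grad \<theta> x) \<le> norm (V x - W k x) * norm (torus_grad \<theta> x)"
        by (simp add: Cauchy_Schwarz_ineq2)
      also have "\<dots> \<le> norm (V x - W k x) * C"
        by (intro mult_left_mono C) simp
      finally show ?thesis
        by (simp add: mult.commute)
    qed
    have i2: "integrable \<mu> (\<lambda>x. (V x - W k x) \<bullet> torus_grad \<theta> x)" for k
      by (rule Bochner_Integration.integrable_bound[OF integrable_mult_right[OF integrable_norm[OF L1(1)], of C k]])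
        (use bnd[of _ k] C(1) in \<open>auto simp: abs_mult\<close>)
    have "(\<lambda>k. a k - (\<integral>x. V x \<bullet> torus_grad \<theta> x \<partial>\<mu>)) \<longlonglongrightarrow> 0"
    proof (rule Lim_null_comparison)
      have "norm (a k - (\<integral>x. V x \<bullet> torus_grad \<theta> x \<partial>\<mu>)) \<le> C * (5 / 2 * (1/2) ^ k)" for k
      proof -
        have "(\<integral>x. (V x - W k x) \<bullet> torus_grad \<theta> x + W k x \<bullet> torus_grad \<theta> x \<partial>\<mu>) =
            (\<integral>x. (V x - W k x) \<bullet> torus_grad \<theta> x \<partial>\<mu>) + a k"
          unfolding a_def by (rule Bochner_Integration.integral_add[OF i2 i1])
        then have "norm (a k - (\<integral>x. V x \<bullet> torus_grad \<theta> x \<partial>\<mu>)) = norm (\<integral>x. (V x - W k x) \<bullet> torus_grad \<theta> x \<partial>\<mu>)"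
          by (simp add: inner_diff_left)
        also have "\<dots> \<le> (\<integral>x. C * norm (V x - W k x) \<partial>\<mu>)"
          by (rule order_trans[OF integral_norm_bound integral_mono])
            (use i2 L1(1) bnd in auto)
        also have "\<dots> \<le> C * (5 / 2 * (1/2) ^ k)"
          using L1(2)[of k] C(1) by simp
        finally show ?thesis .
      qed
      then show "\<forall>\<^sub>F k in sequentially. norm (a k - (\<integral>x. V x \<bullet> torus_grad \<theta> x \<partial>\<mu>)) \<le> C * (5 / 2 * (1/2) ^ k)"
        by simp
      show "(\<lambda>k. C * (5 / 2 * (1/2 :: real) ^ k)) \<longlonglongrightarrow> 0"
        by (intro tendsto_mult_right_zero LIMSEQ_power_zero) simp
    qed
    then have a: "a \<longlonglongrightarrow> (\<integral>x. V x \<bullet> torus_grad \<theta> x \<partial>\<mu>)"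
      by (simp add: LIM_zero_iff)
    fix t :: real
    \<comment> \<open>The perturbed function has energy at least \<open>2 * F \<mu> P\<close>, while
      that of \<open>\<phi> k\<close> exceeds this value by less than its tolerance.\<close>
    have "0 \<le> 2 * t * a k + t\<^sup>2 * b + ((1/2) ^ k)\<^sup>2" for k
      using F_le_energy[OF C1_torus_lincomb(1)[OF C1[of k] \<theta>], of \<mu> P 1 t] min[of k]
      unfolding energy_expand[OF assms C1[of k] \<theta>] a_def b_def W_def by linarith
    moreover have "(\<lambda>k. 2 * t * a k + t\<^sup>2 * b + ((1/2) ^ k)\<^sup>2) \<longlonglongrightarrow> 2 * t * (\<integral>x. V x \<bullet> torus_grad \<theta> x \<partial>\<mu>) + t\<^sup>2 * b + 0\<^sup>2"
      by (intro tendsto_intros a LIMSEQ_power_zero) simp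
    ultimately show "0 \<le> 2 * t * (\<integral>x. V x \<bullet> torus_grad \<theta> x \<partial>\<mu>) + t\<^sup>2 * b"
      using LIMSEQ_le_const[where a = 0] by fastforce
  qed
  have \<nu>: "\<nu> \<in> Lam \<mu>"
    unfolding Lam_def
  proof (intro CollectI conjI allI impI)
    show "\<nu> \<in> borel_probs"
      unfolding borel_probs_def \<nu>_def using prob_space_distr[OF graph] by simp
    show "distr \<nu> borel fst = \<mu>"
      unfolding \<nu>_def using distr_id2[of borel \<mu>] borel_probsD(2)[OF assms]
      by (subst distr_distr[OF _ graph]) (simp_all add: comp_def)
    show "integrable \<nu> (\<lambda>(x, p). (norm p)\<^sup>2)"
      unfolding \<nu>_def case_prod_unfold
      by (subst integrable_distr_eq[OF graph])
        (use V_int in \<open>auto intro!: borel_measurable_continuous_onI continuous_intros\<close>)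
    fix \<theta> :: "'a torus \<Rightarrow> real" assume \<theta>: "C1_torus \<theta>"
    have "continuous_on UNIV (\<lambda>z :: 'a torus \<times> (real ^ 'a). snd z \<bullet> torus_grad \<theta> (fst z))"
      by (intro continuous_intros continuous_on_compose2[OF C1_torusD(2)[OF \<theta>]]) auto
    then show "(\<integral>(x, p). p \<bullet> torus_grad \<theta> x \<partial>\<nu>) = 0"
      unfolding \<nu>_def case_prod_unfold
      by (subst integral_distr[OF graph]) (auto simp: divfree[OF \<theta>] intro: borel_measurable_continuous_onI)
  qed
  have "action P \<nu> = - F \<mu> P"
  proof -
    \<comment> \<open>On the graph measure the squared distance to the graph of \<open>W k\<close>
      is the squared L^2 distance from \<open>V\<close> to \<open>W k\<close>. It tends to zero,
      which forces the action down to \<open>- F \<mu> P\<close>.\<close>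
    have eq: "2 * action P \<nu> + energy \<mu> P (\<phi> k) = (\<integral>x. (norm (V x - W k x))\<^sup>2 \<partial>\<mu>)" for k
    proof -
      have "continuous_on UNIV (\<lambda>z :: 'a torus \<times> (real ^ 'a). (norm (snd z - W k (fst z)))\<^sup>2)"
        by (intro continuous_intros continuous_on_compose2[OF contW]) auto
      then have "(\<integral>z. (norm (snd z - W k (fst z)))\<^sup>2 \<partial>\<nu>) = (\<integral>x. (norm (V x - W k x))\<^sup>2 \<partial>\<mu>)"
        unfolding \<nu>_def by (subst integral_distr[OF graph]) (auto intro: borel_measurable_continuous_onI)
      then show ?thesis
        using Lam_dist_gradient(2)[OF \<nu> C1[of k], of P] by (simp add: W_def)
    qed
    have "2 * action P \<nu> + 2 * F \<mu> P \<le> 0"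
    proof (rule LIMSEQ_le_const)
      have "(\<lambda>k. 4 * ((1/2 :: real) ^ k)\<^sup>2) \<longlonglongrightarrow> 4 * 0\<^sup>2"
        by (intro tendsto_intros LIMSEQ_power_zero) simp
      then show "(\<lambda>k. 4 * ((1/2 :: real) ^ k)\<^sup>2) \<longlonglongrightarrow> 0"
        by simp
      have "2 * action P \<nu> + 2 * F \<mu> P \<le> 4 * ((1/2) ^ k)\<^sup>2" for k
      proof -
        have "2 * action P \<nu> + 2 * F \<mu> P \<le> 2 * action P \<nu> + energy \<mu> P (\<phi> k)"
          by (intro add_left_mono F_le_energy C1)
        also note eq
        also note V(3)
        finally show ?thesis .
      qed
      then show "\<exists>N. \<forall>k\<ge>N. 2 * action P \<nu> + 2 * F \<mu> P \<le> 4 * ((1/2) ^ k)\<^sup>2"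
        by blast
    qed
    then show ?thesis
      using action_ge[OF \<nu>, of P] by simp
  qed
  with \<nu> show thesis
    by (rule that)
qed

text \<open>The lower bound of \<open>action_ge\<close> is attained, so minimising the action and
  reaching the bound are the same.\<close>

lemma weak_solution_iff:
  assumes "\<mu> \<in> borel_probs"
  shows "weak_solution \<mu> P \<nu> \<longleftrightarrow> \<nu> \<in> Lam \<mu> \<and> action P \<nu> = - F \<mu> P"
proof -
  obtain \<nu>' where "\<nu>' \<in> Lam \<mu>" "action P \<nu>' = - F \<mu> P"
    using Lam_exists_optimal[OF assms] .
  then show ?thesis
    unfolding weak_solution_def action_def[symmetric]
    by (metis action_ge order_antisym)
qed

section \<open>Convergence of weak solutions\<close>

text \<open>On compact sets of momenta \<open>f\<close> is uniformly continuous; large momenta and large distances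
  are absorbed by the two quadratic terms, because \<open>f\<close> is bounded.\<close>

lemma bounded_continuous_quadratic_modulus:
  fixes f :: "'n::finite torus \<times> (real ^ 'n) \<Rightarrow> real"
  assumes f: "continuous_on UNIV f" "bounded (range f)" and "0 < e" "0 < \<kappa>"
  obtains C where "0 < C"
    "\<And>x p q. \<bar>f (x, p) - f (x, q)\<bar> \<le> e + C * (norm (p - q))\<^sup>2 + \<kappa> * (norm q)\<^sup>2"
proof -
  obtain M where M: "0 < M" "\<And>z. \<bar>f z\<bar> \<le> M"
    using f(2) by (auto simp: bounded_pos)
  \<comment> \<open>\<open>R\<close>, and later \<open>C\<close>, make
    \<open>\<kappa> * R\<^sup>2\<close> and \<open>C * \<delta>\<^sup>2\<close> equal to
    \<open>2 * M\<close>, which bounds the oscillation of \<open>f\<close>.\<close>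
  define R where "R = sqrt (2 * M / \<kappa>)"
  have R: "0 < R" "\<kappa> * R\<^sup>2 = 2 * M"
    using M(1) assms(4) by (auto simp: R_def)
  \<comment> \<open>The extra 1 in the radius leaves room for \<open>p\<close>, which will be within
    \<open>\<delta> \<le> 1\<close> of \<open>q\<close>; the cube represents every torus
    point.\<close>
  define K where "K = cbox 0 (1 :: real ^ 'n) \<times> cball (0 :: real ^ 'n) (R + 1)"
  define g where "g z = f (abs_torus (fst z), snd z)" for z :: "(real ^ 'n) \<times> (real ^ 'n)"
  have "continuous_on K g"
    unfolding g_def
    by (intro continuous_on_compose2[OF f(1)] continuous_intros continuous_on_compose2[OF continuous_on_abs_torus]) auto
  moreover have "compact K"
    unfolding K_def by (intro compact_Times compact_cbox compact_cball)
  ultimately have "uniformly_continuous_on K g"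
    by (rule compact_uniformly_continuous)
  then obtain d where d: "0 < d" "\<And>z w. z \<in> K \<Longrightarrow> w \<in> K \<Longrightarrow> dist w z < d \<Longrightarrow> dist (g w) (g z) < e"
    using assms(3) unfolding uniformly_continuous_on_def by metis
  define \<delta> where "\<delta> = min d 1"
  have \<delta>: "0 < \<delta>" "\<delta> \<le> d" "\<delta> \<le> 1"
    using d(1) by (auto simp: \<delta>_def)
  define C where "C = 2 * M / \<delta>\<^sup>2"
  have C: "0 < C" "C * \<delta>\<^sup>2 = 2 * M"
    using M(1) \<delta>(1) by (auto simp: C_def)
  have "\<bar>f (x, p) - f (x, q)\<bar> \<le> e + C * (norm (p - q))\<^sup>2 + \<kappa> * (norm q)\<^sup>2" for x p q
  proof -
    have diff: "\<bar>f (x, p) - f (x, q)\<bar> \<le> 2 * M"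
      using M(2)[of "(x, p)"] M(2)[of "(x, q)"] by linarith
    have nonneg: "0 \<le> C * (norm (p - q))\<^sup>2" "0 \<le> \<kappa> * (norm q)\<^sup>2"
      using C(1) assms(4) by auto
    consider "R < norm q" | "\<delta> \<le> norm (p - q)" | "norm q \<le> R" "norm (p - q) < \<delta>"
      by linarith
    then show ?thesis
    proof cases
      case 1
      then have "\<kappa> * R\<^sup>2 \<le> \<kappa> * (norm q)\<^sup>2"
        using R(1) assms(4) by (intro mult_left_mono power_mono) auto
      then show ?thesis
        using diff nonneg R(2) assms(3) by linarith
    next
      case 2
      then have "C * \<delta>\<^sup>2 \<le> C * (norm (p - q))\<^sup>2"
        using \<delta>(1) C(1) by (intro mult_left_mono power_mono) auto
      then show ?thesis
        using diff nonneg C(2) assms(3) by linarith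
    next
      case 3
      obtain y where y: "y \<in> fund_cube" "x = abs_torus y"
        by (rule torus_in_fund_cube)
      have "norm p \<le> norm q + norm (p - q)"
        by norm
      then have "(y, p) \<in> K" "(y, q) \<in> K"
        using y(1) fund_cube_subset 3 \<delta>(3) by (auto simp: K_def)
      moreover have "dist (y, p) (y, q) < d"
        using 3(2) \<delta>(2) by (simp add: dist_Pair_Pair dist_norm)
      ultimately have "dist (g (y, p)) (g (y, q)) < e"
        by (intro d(2))
      then show ?thesis
        using nonneg by (simp add: g_def y(2) dist_real_def)
    qed
  qed
  with C(1) show thesis
    by (rule that)
qed

text \<open>Integrate the modulus with \<open>q = \<nabla>\<phi> x + P\<close>. The distance term is
  evaluated by \<open>Lam_dist_gradient\<close>, and the last term becomes the energy through the
  marginal.\<close>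

lemma Lam_graph_approx:
  fixes f :: "'n::finite torus \<times> (real ^ 'n) \<Rightarrow> real"
  assumes f: "continuous_on UNIV f" "bounded (range f)"
    and modulus: "\<And>x p q. \<bar>f (x, p) - f (x, q)\<bar> \<le> e + C * (norm (p - q))\<^sup>2 + \<kappa> * (norm q)\<^sup>2"
    and \<xi>: "\<xi> \<in> Lam \<mu>" and \<phi>: "C1_torus \<phi>"
  shows "\<bar>(\<integral>z. f z \<partial>\<xi>) - (\<integral>x. f (x, torus_grad \<phi> x + P) \<partial>\<mu>)\<bar>
    \<le> e + C * (2 * action P \<xi> + energy \<mu> P \<phi>) + \<kappa> * energy \<mu> P \<phi>"
proof -
  interpret prob_space \<xi> by (rule borel_probsD(1)[OF LamD(1)[OF \<xi>]])
  obtain M where "\<And>z. norm (f z) \<le> M"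
    using f(2) by (auto simp: bounded_pos)
  then have i1: "integrable \<xi> f"
    by (intro integrable_const_bound[of _ M] measurable_continuous_borel_probs[OF LamD(1)[OF \<xi>] f(1)]) auto
  have "continuous_on UNIV (\<lambda>x. f (x, torus_grad \<phi> x + P))"
    by (intro continuous_on_compose2[OF f(1)] continuous_intros C1_torusD(2)[OF \<phi>]) auto
  note g = Lam_integral_fst[OF \<xi> this]
  note d = Lam_dist_gradient[OF \<xi> \<phi>, of P]
  note s = Lam_integral_fst[OF \<xi> continuous_on_energy_density(2)[OF \<phi>], of P]
  have "\<bar>(\<integral>z. f z \<partial>\<xi>) - (\<integral>x. f (x, torus_grad \<phi> x + P) \<partial>\<mu>)\<bar> =
      \<bar>\<integral>z. f z - f (fst z, torus_grad \<phi> (fst z) + P) \<partial>\<xi>\<bar>"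
    using i1 g by simp
  also have "\<dots> \<le> (\<integral>z. \<bar>f z - f (fst z, torus_grad \<phi> (fst z) + P)\<bar> \<partial>\<xi>)"
    by (rule integral_abs_bound)
  also have "\<dots> \<le> (\<integral>z. e + C * (norm (snd z - (torus_grad \<phi> (fst z) + P)))\<^sup>2
      + \<kappa> * (norm (torus_grad \<phi> (fst z) + P))\<^sup>2 \<partial>\<xi>)"
  proof (rule integral_mono)
    show "integrable \<xi> (\<lambda>z. \<bar>f z - f (fst z, torus_grad \<phi> (fst z) + P)\<bar>)"
      using i1 g(1) by auto
    show "integrable \<xi> (\<lambda>z. e + C * (norm (snd z - (torus_grad \<phi> (fst z) + P)))\<^sup>2
        + \<kappa> * (norm (torus_grad \<phi> (fst z) + P))\<^sup>2)"
      using d(1) s(1) by auto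
    show "\<bar>f z - f (fst z, torus_grad \<phi> (fst z) + P)\<bar> \<le> e + C * (norm (snd z - (torus_grad \<phi> (fst z) + P)))\<^sup>2
        + \<kappa> * (norm (torus_grad \<phi> (fst z) + P))\<^sup>2" for z
      using modulus[of "fst z" "snd z"] by simp
  qed
  also have "\<dots> = e + C * (2 * action P \<xi> + energy \<mu> P \<phi>) + \<kappa> * energy \<mu> P \<phi>"
    unfolding d(2)[symmetric] using d(1) s by (simp add: prob_space energy_def)
  finally show ?thesis .
qed

lemma energy_tendsto:
  assumes "weak_star_conv \<mu>s \<mu>" "C1_torus \<phi>"
  shows "(\<lambda>j. energy (\<mu>s j) P \<phi>) \<longlonglongrightarrow> energy \<mu> P \<phi>"
  using assms(1) continuous_on_energy_density(2)[OF assms(2), of P]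
  unfolding weak_star_conv_def energy_def by blast

lemma weak_solutions_converge:
  fixes P :: "real ^ 'n::finite"
  assumes \<mu>s: "\<And>j. \<mu>s j \<in> borel_probs" and \<mu>: "\<mu> \<in> borel_probs"
    and conv: "weak_star_conv \<mu>s \<mu>" and Fconv: "(\<lambda>j. F (\<mu>s j) P) \<longlonglongrightarrow> F \<mu> P"
    and sol: "\<And>j. weak_solution (\<mu>s j) P (\<nu>s j)" "weak_solution \<mu> P \<nu>"
  shows "weak_conv_meas \<nu>s \<nu>"
  unfolding weak_conv_meas_def
proof (intro allI impI, elim conjE)
  fix f :: "'n torus \<times> (real ^ 'n) \<Rightarrow> real"
  assume f: "continuous_on UNIV f" "bounded (range f)"
  have \<nu>s: "\<nu>s j \<in> Lam (\<mu>s j)" "action P (\<nu>s j) = - F (\<mu>s j) P" for j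
    using sol(1)[of j] weak_solution_iff[OF \<mu>s] by auto
  have \<nu>: "\<nu> \<in> Lam \<mu>" "action P \<nu> = - F \<mu> P"
    using sol(2) weak_solution_iff[OF \<mu>] by auto
  show "(\<lambda>j. \<integral>z. f z \<partial>\<nu>s j) \<longlonglongrightarrow> (\<integral>z. f z \<partial>\<nu>)"
  proof (rule tendstoI)
    fix \<epsilon> :: real assume "0 < \<epsilon>"
    \<comment> \<open>Seven parts: \<open>3 * e\<close> for each of the two measures against the
      graph, and one for the integrals of \<open>f\<close> along the graph.\<close>
    define e where "e = \<epsilon> / 7"
    \<comment> \<open>A bound for the energies of the test function; with
      \<open>\<kappa> = e / B\<close> the last modulus term costs at most \<open>e\<close>.\<close>
    define B where "B = 2 * F \<mu> P + 1"
    have e: "0 < e"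
      using \<open>0 < \<epsilon>\<close> by (simp add: e_def)
    have "0 \<le> 2 * F \<mu> P"
      by (rule F_greatest[OF energy_nonneg])
    then have B: "0 < B"
      by (simp add: B_def)
    obtain C where C: "0 < C"
      "\<And>x p q. \<bar>f (x, p) - f (x, q)\<bar> \<le> e + C * (norm (p - q))\<^sup>2 + e / B * (norm q)\<^sup>2"
      using bounded_continuous_quadratic_modulus[OF f e divide_pos_pos[OF e B]] by metis
    \<comment> \<open>The 1 keeps the energy below \<open>B\<close>; \<open>e / C\<close> keeps the
      distance term below \<open>e\<close>.\<close>
    have "0 < min 1 (e / C)"
      using e C(1) by simp
    then obtain \<phi> where \<phi>: "C1_torus \<phi>" "energy \<mu> P \<phi> < 2 * F \<mu> P + min 1 (e / C)"
      by (rule F_approx)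
    let ?I = "\<lambda>\<mu>. \<integral>x. f (x, torus_grad \<phi> x + P) \<partial>\<mu>"
    have near: "\<bar>(\<integral>z. f z \<partial>\<xi>) - ?I m\<bar> \<le> 3 * e"
      if "\<xi> \<in> Lam m" "action P \<xi> = - F m P" "energy m P \<phi> - 2 * F m P < e / C" "energy m P \<phi> < B" for \<xi> m
    proof -
      have "C * (2 * action P \<xi> + energy m P \<phi>) \<le> C * (e / C)"
        using C(1) that(2,3) by (intro mult_left_mono) auto
      moreover have "e / B * energy m P \<phi> \<le> e / B * B"
        using that(4) e B by (intro mult_left_mono) auto
      ultimately show ?thesis
        using Lam_graph_approx[OF f C(2) that(1) \<phi>(1), of P] C(1) B by simp
    qed
    \<comment> \<open>Here the assumed convergence of the values of \<open>F\<close> enters: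
      near-optimality of \<phi> passes from \<mu> to \<open>\<mu>s j\<close> for large
      \<open>j\<close>.\<close>
    have "(\<lambda>j. energy (\<mu>s j) P \<phi> - 2 * F (\<mu>s j) P) \<longlonglongrightarrow> energy \<mu> P \<phi> - 2 * F \<mu> P"
      by (intro tendsto_intros energy_tendsto[OF conv \<phi>(1)] Fconv)
    then have "\<forall>\<^sub>F j in sequentially. energy (\<mu>s j) P \<phi> - 2 * F (\<mu>s j) P < e / C"
      by (rule order_tendstoD) (use \<phi>(2) in linarith)
    moreover have "\<forall>\<^sub>F j in sequentially. energy (\<mu>s j) P \<phi> < B"
      by (rule order_tendstoD[OF energy_tendsto[OF conv \<phi>(1)]]) (use \<phi>(2) in \<open>simp add: B_def\<close>)
    moreover have "continuous_on UNIV (\<lambda>x. f (x, torus_grad \<phi> x + P))"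
      by (intro continuous_on_compose2[OF f(1)] continuous_intros C1_torusD(2)[OF \<phi>(1)]) auto
    then have "(\<lambda>j. ?I (\<mu>s j)) \<longlonglongrightarrow> ?I \<mu>"
      using conv by (simp add: weak_star_conv_def)
    then have "\<forall>\<^sub>F j in sequentially. dist (?I (\<mu>s j)) (?I \<mu>) < e"
      using e by (rule tendstoD)
    ultimately show "\<forall>\<^sub>F j in sequentially. dist (\<integral>z. f z \<partial>\<nu>s j) (\<integral>z. f z \<partial>\<nu>) < \<epsilon>"
    proof eventually_elim
      case (elim j)
      have "\<bar>(\<integral>z. f z \<partial>\<nu>s j) - ?I (\<mu>s j)\<bar> \<le> 3 * e"
        by (rule near[OF \<nu>s]) (use elim in auto)
      moreover have "\<bar>(\<integral>z. f z \<partial>\<nu>) - ?I \<mu>\<bar> \<le> 3 * e"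
        by (rule near[OF \<nu>]) (use \<phi>(2) in \<open>auto simp: B_def\<close>)
      ultimately show ?case
        using elim(3) unfolding dist_real_def e_def by linarith
    qed
  qed
qed

section \<open>Lebesgue measure on the torus\<close>

lemma measurable_fund_cube [measurable]: "fund_cube \<in> sets borel"
  unfolding fund_cube_def by measurable

text \<open>The half-open cube lies between the open and the closed unit cube.\<close>

lemma emeasure_fund_cube: "emeasure lborel (fund_cube :: (real ^ 'n::finite) set) = 1"
proof -
  have [simp]: "1 \<bullet> b = 1" if "b \<in> Basis" for b :: "real ^ 'n"
    using that by (auto simp: Basis_vec_def inner_axis)
  have "emeasure lborel (box 0 (1 :: real ^ 'n)) = 1" "emeasure lborel (cbox 0 (1 :: real ^ 'n)) = 1"
    by (simp_all add: emeasure_lborel_box_eq emeasure_lborel_cbox_eq)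
  moreover have "emeasure lborel (box 0 (1 :: real ^ 'n)) \<le> emeasure lborel (fund_cube :: (real ^ 'n) set)"
    by (intro emeasure_mono) (auto simp: fund_cube_def mem_box_cart less_imp_le)
  moreover have "emeasure lborel (fund_cube :: (real ^ 'n) set) \<le> emeasure lborel (cbox 0 (1 :: real ^ 'n))"
    by (intro emeasure_mono fund_cube_subset) simp
  ultimately show ?thesis
    by simp
qed

lemma nn_integral_torus_lebesgue:
  assumes [measurable]: "f \<in> borel_measurable borel"
  shows "(\<integral>\<^sup>+q. f q \<partial>torus_lebesgue) = (\<integral>\<^sup>+x. f (abs_torus x) * indicator fund_cube x \<partial>lborel)"
proof -
  have "abs_torus \<in> measurable (restrict_space lborel fund_cube) borel"
    by (rule measurable_restrict_space1) simp
  then have "(\<integral>\<^sup>+q. f q \<partial>torus_lebesgue) = (\<integral>\<^sup>+x. f (abs_torus x) \<partial>restrict_space lborel fund_cube)"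
    unfolding torus_lebesgue_def fund_cube_def[symmetric] by (subst nn_integral_distr) auto
  also have "\<dots> = (\<integral>\<^sup>+x. f (abs_torus x) * indicator fund_cube x \<partial>lborel)"
    by (rule nn_integral_restrict_space) simp
  finally show ?thesis .
qed

lemma torus_lebesgue_borel_probs: "torus_lebesgue \<in> borel_probs"
proof -
  have "emeasure (torus_lebesgue :: 'a torus measure) (space torus_lebesgue) = (\<integral>\<^sup>+q. 1 \<partial>(torus_lebesgue :: 'a torus measure))"
    by simp
  also have "\<dots> = (\<integral>\<^sup>+x. 1 * indicator fund_cube x \<partial>(lborel :: (real ^ 'a) measure))"
    by (rule nn_integral_torus_lebesgue) simp
  also have "\<dots> = 1"
    by (simp add: emeasure_fund_cube)
  finally have "prob_space (torus_lebesgue :: 'a torus measure)"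
    by (rule prob_spaceI)
  then show ?thesis
    by (simp add: borel_probs_def torus_lebesgue_def)
qed

lemma nn_integral_lborel_add:
  fixes c :: "'a::euclidean_space"
  assumes [measurable]: "f \<in> borel_measurable borel"
  shows "(\<integral>\<^sup>+x. f (x + c) \<partial>lborel) = (\<integral>\<^sup>+x. f x \<partial>lborel)"
  by (subst (2) lborel_distr_plus[of c, symmetric], subst nn_integral_distr) (auto simp: add.commute)

text \<open>Lattice points indexed by a countable type, so that sums over the lattice are integrals
  for \<open>count_space\<close> and Tonelli applies.\<close>

definition intv :: "('n::finite \<Rightarrow> int) \<Rightarrow> real ^ 'n" where
  "intv k = (\<chi> i. of_int (k i))"

lemma intv_int_vec [simp]: "intv k \<in> int_vec"
  by (simp add: intv_def int_vec_def)

text \<open>Exactly one index contributes: the componentwise floor of \<open>y\<close>, or its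
  negative in the second form.\<close>

lemma fund_cube_tiling:
  fixes y :: "real ^ 'n::finite"
  shows "(\<integral>\<^sup>+k. indicator fund_cube (y - intv k) \<partial>count_space UNIV) = 1"
    and "(\<integral>\<^sup>+k. indicator fund_cube (y + intv k) \<partial>count_space UNIV) = 1"
proof -
  have "y - intv k \<in> fund_cube \<longleftrightarrow> k = (\<lambda>i. \<lfloor>y $ i\<rfloor>)" for k
  proof -
    have "0 \<le> y $ i - real_of_int (k i) \<and> y $ i - real_of_int (k i) < 1 \<longleftrightarrow> k i = \<lfloor>y $ i\<rfloor>" for i
      using floor_eq_iff[of "y $ i" "k i"] by linarith
    then show ?thesis
      by (simp add: fund_cube_def intv_def fun_eq_iff)
  qed
  then have 1: "indicator fund_cube (y - intv k) = indicator {\<lambda>i. \<lfloor>y $ i\<rfloor>} k" for k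
    by (simp add: indicator_def)
  show "(\<integral>\<^sup>+k. indicator fund_cube (y - intv k) \<partial>count_space UNIV) = 1"
    unfolding 1 by simp
  have "y + intv k \<in> fund_cube \<longleftrightarrow> k = (\<lambda>i. - \<lfloor>y $ i\<rfloor>)" for k
  proof -
    have "0 \<le> y $ i + real_of_int (k i) \<and> y $ i + real_of_int (k i) < 1 \<longleftrightarrow> k i = - \<lfloor>y $ i\<rfloor>" for i
      using floor_eq_iff[of "y $ i" "- k i"] by auto
    then show ?thesis
      by (simp add: fund_cube_def intv_def fun_eq_iff)
  qed
  then have 2: "indicator fund_cube (y + intv k) = indicator {\<lambda>i. - \<lfloor>y $ i\<rfloor>} k" for k
    by (simp add: indicator_def)
  show "(\<integral>\<^sup>+k. indicator fund_cube (y + intv k) \<partial>count_space UNIV) = 1"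
    unfolding 2 by simp
qed

text \<open>Both \<open>fund_cube\<close> and its translate by \<open>z\<close> are fundamental domains of the lattice: cutting the
  translate along the tiles of the lattice and moving the pieces back gives \<open>fund_cube\<close>.\<close>

lemma nn_integral_fund_cube_translate:
  fixes g :: "real ^ 'n::finite \<Rightarrow> ennreal"
  assumes [measurable]: "g \<in> borel_measurable borel"
    and periodic: "\<And>x k. k \<in> int_vec \<Longrightarrow> g (x + k) = g x"
  shows "(\<integral>\<^sup>+y. g y * indicator fund_cube (y - z) \<partial>lborel) = (\<integral>\<^sup>+y. g y * indicator fund_cube y \<partial>lborel)"
proof -
  interpret sigma_finite_measure "count_space (UNIV :: ('n \<Rightarrow> int) set)"
    by (rule sigma_finite_measure_count_space_countable) simp
  interpret pair_sigma_finite "count_space (UNIV :: ('n \<Rightarrow> int) set)" "lborel :: (real ^ 'n) measure" ..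
  let ?Q = "\<lambda>x :: real ^ 'n. indicator fund_cube x :: ennreal"
  have swap: "(\<integral>\<^sup>+y. \<integral>\<^sup>+k. f k y \<partial>count_space UNIV \<partial>lborel) = (\<integral>\<^sup>+k. \<integral>\<^sup>+y. f k y \<partial>lborel \<partial>count_space UNIV)"
    if "\<And>k. f k \<in> borel_measurable borel" for f :: "('n \<Rightarrow> int) \<Rightarrow> real ^ 'n \<Rightarrow> ennreal"
  proof -
    have "case_prod f \<in> borel_measurable (count_space UNIV \<Otimes>\<^sub>M lborel)"
      by (rule measurable_pair_measure_countable1) (use that in auto)
    from Fubini[OF this] show ?thesis
      by simp
  qed
  have "(\<integral>\<^sup>+y. g y * ?Q (y - z) \<partial>lborel) = (\<integral>\<^sup>+y. \<integral>\<^sup>+k. g y * ?Q (y - z) * ?Q (y - intv k) \<partial>count_space UNIV \<partial>lborel)"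
    by (simp add: nn_integral_cmult fund_cube_tiling)
  also have "\<dots> = (\<integral>\<^sup>+k. \<integral>\<^sup>+y. g y * ?Q (y - z) * ?Q (y - intv k) \<partial>lborel \<partial>count_space UNIV)"
    by (rule swap) simp
  also have "\<dots> = (\<integral>\<^sup>+k. \<integral>\<^sup>+y. g y * ?Q y * ?Q ((y - z) + intv k) \<partial>lborel \<partial>count_space UNIV)"
  proof (rule nn_integral_cong)
    fix k :: "'n \<Rightarrow> int"
    have "(\<integral>\<^sup>+y. g y * ?Q (y - z) * ?Q (y - intv k) \<partial>lborel) =
        (\<integral>\<^sup>+y. g (y + intv k) * ?Q (y + intv k - z) * ?Q (y + intv k - intv k) \<partial>lborel)"
      by (rule nn_integral_lborel_add[symmetric]) simp
    also have "\<dots> = (\<integral>\<^sup>+y. g y * ?Q y * ?Q ((y - z) + intv k) \<partial>lborel)"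
    proof (rule nn_integral_cong)
      fix y :: "real ^ 'n"
      have "y + intv k - z = (y - z) + intv k" "y + intv k - intv k = y"
        by simp_all
      then show "g (y + intv k) * ?Q (y + intv k - z) * ?Q (y + intv k - intv k) = g y * ?Q y * ?Q ((y - z) + intv k)"
        by (simp only: periodic[OF intv_int_vec] mult.assoc mult.commute[of "?Q y"])
    qed
    finally show "(\<integral>\<^sup>+y. g y * ?Q (y - z) * ?Q (y - intv k) \<partial>lborel) =
        (\<integral>\<^sup>+y. g y * ?Q y * ?Q ((y - z) + intv k) \<partial>lborel)" .
  qed
  also have "\<dots> = (\<integral>\<^sup>+y. \<integral>\<^sup>+k. g y * ?Q y * ?Q ((y - z) + intv k) \<partial>count_space UNIV \<partial>lborel)"
    by (rule swap[symmetric]) simp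
  also have "\<dots> = (\<integral>\<^sup>+y. g y * ?Q y \<partial>lborel)"
    by (simp add: nn_integral_cmult fund_cube_tiling)
  finally show ?thesis .
qed

text \<open>On representatives, translation replaces the fundamental cube by its translate, which
  has the same integral for a periodic integrand.\<close>

lemma nn_integral_torus_lebesgue_translate:
  fixes f :: "'n::finite torus \<Rightarrow> ennreal"
  assumes [measurable]: "f \<in> borel_measurable borel"
  shows "(\<integral>\<^sup>+q. f (q + a) \<partial>torus_lebesgue) = (\<integral>\<^sup>+q. f q \<partial>torus_lebesgue)"
proof -
  obtain z where a: "a = abs_torus z"
    by (rule torus_cases_abs)
  have "continuous_on UNIV (\<lambda>q :: 'n torus. q + a)"
    by (rule continuous_on_torus_plus_const[where f = "\<lambda>q. q", OF continuous_on_id])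
  then have [measurable]: "(\<lambda>q :: 'n torus. q + a) \<in> borel_measurable borel"
    by (rule borel_measurable_continuous_onI)
  have fa: "(\<lambda>q. f (q + a)) \<in> borel_measurable borel"
    by (rule measurable_compose[OF _ assms]) simp
  have "(\<integral>\<^sup>+q. f (q + a) \<partial>torus_lebesgue) = (\<integral>\<^sup>+x. f (abs_torus (x + z)) * indicator fund_cube ((x + z) - z) \<partial>lborel)"
    by (subst nn_integral_torus_lebesgue[OF fa]) (simp_all add: a plus_torus.abs_eq)
  also have "\<dots> = (\<integral>\<^sup>+x. f (abs_torus x) * indicator fund_cube (x - z) \<partial>lborel)"
    by (rule nn_integral_lborel_add) simp
  also have "\<dots> = (\<integral>\<^sup>+x. f (abs_torus x) * indicator fund_cube x \<partial>lborel)"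
    by (rule nn_integral_fund_cube_translate) simp_all
  also have "\<dots> = (\<integral>\<^sup>+q. f q \<partial>torus_lebesgue)"
    by (rule nn_integral_torus_lebesgue[symmetric]) simp
  finally show ?thesis .
qed

lemma integral_torus_lebesgue_translate:
  fixes f :: "'n::finite torus \<Rightarrow> real"
  assumes "continuous_on UNIV f"
  shows "(\<integral>q. f (q + a) \<partial>torus_lebesgue) = (\<integral>q. f q \<partial>torus_lebesgue)"
proof -
  have [measurable]: "f \<in> borel_measurable borel"
    by (rule borel_measurable_continuous_onI[OF assms])
  have "integrable torus_lebesgue (\<lambda>q. f (q + a))" "integrable torus_lebesgue f"
    by (intro integrable_continuous_torus torus_lebesgue_borel_probs continuous_on_torus_plus_const assms)+
  moreover have "(\<integral>\<^sup>+q. ennreal (f (q + a)) \<partial>torus_lebesgue) = (\<integral>\<^sup>+q. ennreal (f q) \<partial>torus_lebesgue)"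
    "(\<integral>\<^sup>+q. ennreal (- f (q + a)) \<partial>torus_lebesgue) = (\<integral>\<^sup>+q. ennreal (- f q) \<partial>torus_lebesgue)"
    by (rule nn_integral_torus_lebesgue_translate, simp)+
  ultimately show ?thesis
    by (simp add: real_lebesgue_integral_def)
qed

text \<open>A representative in the cube may lie on its boundary, but it is in the closure of the
  open cube. The open preimage therefore meets the interior in a nonempty open set, which has
  positive volume.\<close>

lemma measure_torus_lebesgue_open_pos:
  fixes U :: "'n::finite torus set"
  assumes "open U" "U \<noteq> {}"
  shows "0 < measure torus_lebesgue U"
proof -
  interpret prob_space "torus_lebesgue :: 'n torus measure"
    by (rule borel_probsD(1)[OF torus_lebesgue_borel_probs])
  obtain x where x: "x \<in> fund_cube" "abs_torus x \<in> U"
    using assms(2) by (metis ex_in_conv torus_in_fund_cube)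
  define V where "V = abs_torus -` U \<inter> box 0 (1 :: real ^ 'n)"
  have "open (abs_torus -` U)"
    using assms(1) by (simp add: open_torus_def)
  moreover have "box 0 (1 :: real ^ 'n) \<noteq> {}"
    by (simp add: interval_ne_empty_cart)
  then have "x \<in> closure (box 0 1)"
    using x(1) fund_cube_subset by (auto simp: closure_box)
  ultimately have "V \<noteq> {}"
    using x(2) open_Int_closure_eq_empty[of "abs_torus -` U" "box 0 1"] unfolding V_def by blast
  have "open V"
    unfolding V_def by (rule open_Int[OF \<open>open (abs_torus -` U)\<close> open_box])
  have "V \<in> sets lebesgue"
    using \<open>open V\<close> by simp
  then have "emeasure lebesgue V \<noteq> 0"
    using open_not_negligible[OF \<open>open V\<close> \<open>V \<noteq> {}\<close>] negligible_iff_emeasure0 by blast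
  then have "0 < emeasure lborel V"
    using \<open>open V\<close> by (simp add: zero_less_iff_neq_zero)
  also have "emeasure lborel V = (\<integral>\<^sup>+x. indicator V x \<partial>lborel)"
    using \<open>open V\<close> by simp
  also have "\<dots> \<le> (\<integral>\<^sup>+x. indicator U (abs_torus x) * indicator fund_cube x \<partial>lborel)"
    by (intro nn_integral_mono)
      (auto simp: V_def fund_cube_def mem_box_cart less_imp_le split: split_indicator)
  also have "\<dots> = (\<integral>\<^sup>+q. indicator U q \<partial>torus_lebesgue)"
    by (rule nn_integral_torus_lebesgue[symmetric]) (use assms(1) in simp)
  also have "\<dots> = emeasure torus_lebesgue U"
    by (rule nn_integral_indicator) (simp add: assms(1) borel_probsD(2)[OF torus_lebesgue_borel_probs])
  finally show ?thesis
    by (simp add: emeasure_eq_measure)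
qed

section \<open>Convolution\<close>

lemma Fubini_torus:
  fixes g :: "'n::finite torus \<times> 'm::finite torus \<Rightarrow> real"
  assumes "\<mu> \<in> borel_probs" "\<nu> \<in> borel_probs" "continuous_on UNIV g"
  shows "(\<integral>x. (\<integral>y. g (x, y) \<partial>\<nu>) \<partial>\<mu>) = (\<integral>y. (\<integral>x. g (x, y) \<partial>\<mu>) \<partial>\<nu>)"
    and "integrable \<mu> (\<lambda>x. \<integral>y. g (x, y) \<partial>\<nu>)"
proof -
  interpret \<mu>: prob_space \<mu> by (rule borel_probsD(1)[OF assms(1)])
  interpret \<nu>: prob_space \<nu> by (rule borel_probsD(1)[OF assms(2)])
  interpret pair_prob_space \<mu> \<nu> ..
  have "sets (\<mu> \<Otimes>\<^sub>M \<nu>) = sets (borel \<Otimes>\<^sub>M borel)"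
    by (rule sets_pair_measure_cong) (rule borel_probsD(2)[OF assms(1)] borel_probsD(2)[OF assms(2)])+
  also have "\<dots> = sets (borel :: ('n torus \<times> 'm torus) measure)"
    unfolding borel_prod ..
  finally have "sets (\<mu> \<Otimes>\<^sub>M \<nu>) = sets (borel :: ('n torus \<times> 'm torus) measure)" .
  then have "\<mu> \<Otimes>\<^sub>M \<nu> \<in> borel_probs"
    using P.prob_space_axioms by (simp add: borel_probs_def)
  moreover have "compact (UNIV :: ('n torus \<times> 'm torus) set)"
    using compact_Times[OF compact_torus_UNIV compact_torus_UNIV] by simp
  then have "bounded (range g)"
    using compact_continuous_image[OF assms(3)] compact_imp_bounded by blast
  then obtain B where "\<And>z. norm (g z) \<le> B"
    by (auto simp: bounded_pos)
  ultimately have int: "integrable (\<mu> \<Otimes>\<^sub>M \<nu>) (case_prod (\<lambda>x y. g (x, y)))"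
    by (intro P.integrable_const_bound[of _ B]) (auto intro: measurable_continuous_borel_probs assms)
  show "(\<integral>x. (\<integral>y. g (x, y) \<partial>\<nu>) \<partial>\<mu>) = (\<integral>y. (\<integral>x. g (x, y) \<partial>\<mu>) \<partial>\<nu>)"
    by (rule Fubini_integral[OF int, symmetric])
  show "integrable \<mu> (\<lambda>x. \<integral>y. g (x, y) \<partial>\<nu>)"
    by (rule integrable_fst[OF int])
qed

definition torus_conv :: "('n::finite torus \<Rightarrow> real) \<Rightarrow> 'n torus measure \<Rightarrow> 'n torus \<Rightarrow> real" where
  "torus_conv \<eta> \<mu> x = (\<integral>y. \<eta> (x - y) \<partial>\<mu>)"

lemma continuous_on_torus_plus_fst_snd:
  "continuous_on UNIV f \<Longrightarrow> continuous_on UNIV (\<lambda>z. f (fst z + snd z :: 'n::finite torus))"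
  using continuous_on_compose2[OF _ continuous_on_torus_plus, of UNIV f] by (simp add: case_prod_unfold)

lemma continuous_on_torus_minus_fst_snd:
  "continuous_on UNIV f \<Longrightarrow> continuous_on UNIV (\<lambda>z. f (fst z - snd z :: 'n::finite torus))"
  using continuous_on_compose2[OF _ continuous_on_torus_minus, of UNIV f] by (simp add: case_prod_unfold)

text \<open>Fubini followed by the substitution \<open>x = q + y\<close> moves the convolution from
  the density to the test function.\<close>

lemma integral_torus_conv:
  fixes f \<eta> :: "'n::finite torus \<Rightarrow> real"
  assumes \<mu>: "\<mu> \<in> borel_probs" and f: "continuous_on UNIV f" and \<eta>: "continuous_on UNIV \<eta>"
  shows "(\<integral>x. torus_conv \<eta> \<mu> x * f x \<partial>torus_lebesgue) = (\<integral>y. (\<integral>q. \<eta> q * f (q + y) \<partial>torus_lebesgue) \<partial>\<mu>)"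
proof -
  have c: "continuous_on UNIV (\<lambda>z. \<eta> (fst z - snd z) * f (fst z))"
    by (intro continuous_intros continuous_on_torus_minus_fst_snd \<eta> continuous_on_compose2[OF f]) auto
  have "(\<integral>x. torus_conv \<eta> \<mu> x * f x \<partial>torus_lebesgue) = (\<integral>x. (\<integral>y. \<eta> (x - y) * f x \<partial>\<mu>) \<partial>torus_lebesgue)"
    by (simp add: torus_conv_def)
  also have "\<dots> = (\<integral>y. (\<integral>x. \<eta> (x - y) * f x \<partial>torus_lebesgue) \<partial>\<mu>)"
    using Fubini_torus(1)[OF torus_lebesgue_borel_probs \<mu> c] by simp
  also have "\<dots> = (\<integral>y. (\<integral>q. \<eta> q * f (q + y) \<partial>torus_lebesgue) \<partial>\<mu>)"
  proof (rule Bochner_Integration.integral_cong[OF refl])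
    fix y :: "'n torus"
    have "continuous_on UNIV (\<lambda>x. \<eta> (x - y) * f x)"
      using continuous_on_torus_plus_const[OF \<eta>, of "- y"] by (intro continuous_intros f) simp
    from integral_torus_lebesgue_translate[OF this, of y]
    show "(\<integral>x. \<eta> (x - y) * f x \<partial>torus_lebesgue) = (\<integral>q. \<eta> q * f (q + y) \<partial>torus_lebesgue)"
      by simp
  qed
  finally show ?thesis .
qed

lemma integral_density_torus:
  fixes f \<rho> :: "'n::finite torus \<Rightarrow> real"
  assumes "continuous_on UNIV \<rho>" "\<And>x. 0 \<le> \<rho> x" "continuous_on UNIV f"
  shows "(\<integral>x. f x \<partial>density torus_lebesgue (\<lambda>x. ennreal (\<rho> x))) = (\<integral>x. \<rho> x * f x \<partial>torus_lebesgue)"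
  using measurable_continuous_borel_probs[OF torus_lebesgue_borel_probs assms(1)]
    measurable_continuous_borel_probs[OF torus_lebesgue_borel_probs assms(3)] assms(2)
  by (subst integral_density) auto

lemma density_torus_conv_borel_probs:
  fixes \<eta> :: "'n::finite torus \<Rightarrow> real"
  assumes \<mu>: "\<mu> \<in> borel_probs" and \<eta>: "continuous_on UNIV \<eta>" "(\<integral>q. \<eta> q \<partial>torus_lebesgue) = 1"
    and \<rho>: "continuous_on UNIV (torus_conv \<eta> \<mu>)" "\<And>x. 0 \<le> torus_conv \<eta> \<mu> x"
  shows "density torus_lebesgue (\<lambda>x. ennreal (torus_conv \<eta> \<mu> x)) \<in> borel_probs"
proof -
  interpret \<mu>: prob_space \<mu> by (rule borel_probsD(1)[OF \<mu>])
  have [measurable]: "torus_conv \<eta> \<mu> \<in> borel_measurable torus_lebesgue"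
    by (rule measurable_continuous_borel_probs[OF torus_lebesgue_borel_probs \<rho>(1)])
  \<comment> \<open>Total mass, from the duality formula with test function 1.\<close>
  have "(\<integral>x. torus_conv \<eta> \<mu> x \<partial>torus_lebesgue) = 1"
    using integral_torus_conv[OF \<mu> continuous_on_const \<eta>(1), of 1] \<eta>(2) by (simp add: \<mu>.prob_space)
  then have "(\<integral>\<^sup>+x. ennreal (torus_conv \<eta> \<mu> x) \<partial>torus_lebesgue) = 1"
    using \<rho> by (subst nn_integral_eq_integral)
      (auto intro: integrable_continuous_torus[OF torus_lebesgue_borel_probs])
  then have "emeasure (density torus_lebesgue (\<lambda>x. ennreal (torus_conv \<eta> \<mu> x)))
      (space (density torus_lebesgue (\<lambda>x. ennreal (torus_conv \<eta> \<mu> x)))) = 1"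
    by (subst emeasure_density) (auto cong: nn_integral_cong)
  then have "prob_space (density torus_lebesgue (\<lambda>x. ennreal (torus_conv \<eta> \<mu> x)))"
    by (rule prob_spaceI)
  then show ?thesis
    using borel_probsD(2)[OF torus_lebesgue_borel_probs] by (simp add: borel_probs_def)
qed

text \<open>The energy of a convolution is an average of energies of translated test functions.\<close>

lemma F_le_F_conv:
  fixes \<eta> :: "'n::finite torus \<Rightarrow> real"
  assumes \<mu>: "\<mu> \<in> borel_probs"
    and \<eta>: "continuous_on UNIV \<eta>" "(\<integral>q. \<eta> q \<partial>torus_lebesgue) = 1" "\<And>q. 0 \<le> \<eta> q"
    and \<rho>: "continuous_on UNIV (torus_conv \<eta> \<mu>)"
  shows "F \<mu> P \<le> F (density torus_lebesgue (\<lambda>x. ennreal (torus_conv \<eta> \<mu> x))) P"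
proof -
  let ?\<mu>' = "density torus_lebesgue (\<lambda>x. ennreal (torus_conv \<eta> \<mu> x))"
  have "2 * F \<mu> P \<le> energy ?\<mu>' P \<phi>" if \<phi>: "C1_torus \<phi>" for \<phi>
  proof -
    let ?f = "\<lambda>x. (norm (torus_grad \<phi> x + P))\<^sup>2"
    note f = continuous_on_energy_density(2)[OF \<phi>, of P]
    have "continuous_on UNIV (\<lambda>z. \<eta> (fst z) * ?f (fst z + snd z))"
      by (intro continuous_on_mult continuous_on_torus_plus_fst_snd f continuous_on_compose2[OF \<eta>(1)])
        (auto intro: continuous_on_fst continuous_on_id)
    note Fub = Fubini_torus[OF torus_lebesgue_borel_probs \<mu> this]
    have shift: "(\<integral>y. \<eta> q * ?f (q + y) \<partial>\<mu>) = \<eta> q * energy \<mu> P (\<lambda>x. \<phi> (x + q))" for q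
      by (simp add: energy_def C1_torus_translate(2)[OF \<phi>] add.commute[of q])
    have "2 * F \<mu> P = (\<integral>q. \<eta> q * (2 * F \<mu> P) \<partial>torus_lebesgue)"
      using \<eta>(2) by simp
    also have "\<dots> \<le> (\<integral>q. (\<integral>y. \<eta> q * ?f (q + y) \<partial>\<mu>) \<partial>torus_lebesgue)"
    proof (rule integral_mono)
      show "integrable torus_lebesgue (\<lambda>q. \<eta> q * (2 * F \<mu> P))"
        by (intro integrable_mult_left integrable_continuous_torus[OF torus_lebesgue_borel_probs] \<eta>)
      show "integrable torus_lebesgue (\<lambda>q. \<integral>y. \<eta> q * ?f (q + y) \<partial>\<mu>)"
        using Fub(2) by simp
      show "\<eta> q * (2 * F \<mu> P) \<le> (\<integral>y. \<eta> q * ?f (q + y) \<partial>\<mu>)" for q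
        unfolding shift by (intro mult_left_mono F_le_energy C1_torus_translate \<phi> \<eta>)
    qed
    also have "\<dots> = (\<integral>y. (\<integral>q. \<eta> q * ?f (q + y) \<partial>torus_lebesgue) \<partial>\<mu>)"
      using Fub(1) by simp
    also have "\<dots> = (\<integral>x. torus_conv \<eta> \<mu> x * ?f x \<partial>torus_lebesgue)"
      by (rule integral_torus_conv[OF \<mu> f \<eta>(1), symmetric])
    also have "\<dots> = energy ?\<mu>' P \<phi>"
      unfolding energy_def
      by (rule integral_density_torus[symmetric, OF \<rho> _ f]) (simp add: torus_conv_def \<eta>(3))
    finally show ?thesis .
  qed
  then have "2 * F \<mu> P \<le> 2 * F ?\<mu>' P"
    by (rule F_greatest)
  then show ?thesis by simp
qed

text \<open>The lower bound is assumed. For the upper one, the energy of a fixed near-minimiser for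
  \<mu> converges and dominates the values of \<open>F\<close> along the sequence.\<close>

lemma F_tendsto_if_ge:
  assumes "weak_star_conv \<mu>s \<mu>" "\<And>j. F \<mu> P \<le> F (\<mu>s j) P"
  shows "(\<lambda>j. F (\<mu>s j) P) \<longlonglongrightarrow> F \<mu> P"
proof (rule order_tendstoI)
  show "\<forall>\<^sub>F j in sequentially. a < F (\<mu>s j) P" if "a < F \<mu> P" for a
    using that assms(2) less_le_trans by (intro always_eventually) blast
  fix a assume "F \<mu> P < a"
  then have "0 < 2 * (a - F \<mu> P)"
    by simp
  then obtain \<phi> where \<phi>: "C1_torus \<phi>" "energy \<mu> P \<phi> < 2 * F \<mu> P + 2 * (a - F \<mu> P)"
    by (rule F_approx)
  have "\<forall>\<^sub>F j in sequentially. energy (\<mu>s j) P \<phi> < 2 * a"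
    by (rule order_tendstoD[OF energy_tendsto[OF assms(1) \<phi>(1)]]) (use \<phi>(2) in simp)
  then show "\<forall>\<^sub>F j in sequentially. F (\<mu>s j) P < a"
  proof eventually_elim
    case (elim j)
    have "2 * F (\<mu>s j) P \<le> energy (\<mu>s j) P \<phi>"
      by (rule F_le_energy[OF \<phi>(1)])
    with elim show ?case
      by simp
  qed
qed

section \<open>Peaked kernels\<close>

text \<open>Powers concentrate at the maximum of \<open>H\<close> and stay within the trigonometric
  polynomials.\<close>

definition peak :: "('n::finite torus \<Rightarrow> real) \<Rightarrow> nat \<Rightarrow> 'n torus \<Rightarrow> real" where
  "peak H j q = H q ^ j / (\<integral>r. H r ^ j \<partial>torus_lebesgue)"

text \<open>Chebyshev's inequality, used to bound the normalising integrals of \<open>peak\<close>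
  from below.\<close>

lemma integral_torus_ge_measure:
  fixes H :: "'n::finite torus \<Rightarrow> real"
  assumes "continuous_on UNIV H" "\<And>q. 0 \<le> H q" "open B" "\<And>q. q \<in> B \<Longrightarrow> c \<le> H q"
  shows "measure torus_lebesgue B * c \<le> (\<integral>r. H r \<partial>torus_lebesgue)"
proof -
  interpret prob_space "torus_lebesgue :: 'n torus measure"
    by (rule borel_probsD(1)[OF torus_lebesgue_borel_probs])
  have B: "B \<in> sets torus_lebesgue"
    using assms(3) by (simp add: borel_probsD(2)[OF torus_lebesgue_borel_probs])
  have "measure torus_lebesgue B * c = (\<integral>r. c * indicator B r \<partial>torus_lebesgue)"
    using B by (simp add: borel_probsD(3)[OF torus_lebesgue_borel_probs])
  also have "\<dots> \<le> (\<integral>r. H r \<partial>torus_lebesgue)"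
  proof (rule integral_mono)
    show "integrable torus_lebesgue (\<lambda>r. c * indicator B r)"
      using B by (intro integrable_mult_right integrable_real_indicator) (auto simp: emeasure_eq_measure)
    show "integrable torus_lebesgue H"
      by (rule integrable_continuous_torus[OF torus_lebesgue_borel_probs assms(1)])
    show "c * indicator B r \<le> H r" for r
      using assms(2,4) by (auto split: split_indicator)
  qed
  finally show "measure torus_lebesgue B * c \<le> (\<integral>r. H r \<partial>torus_lebesgue)" .
qed

lemma peak_props:
  fixes H :: "'n::finite torus \<Rightarrow> real"
  assumes H: "continuous_on UNIV H" "\<And>q. 0 < H q"
  shows "0 < (\<integral>r. H r ^ j \<partial>torus_lebesgue)" "continuous_on UNIV (peak H j)" "0 < peak H j q"
    "(\<integral>q. peak H j q \<partial>torus_lebesgue) = 1"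
proof -
  obtain q0 where "\<And>q. H q0 \<le> H q"
    using continuous_attains_inf[OF compact_torus_UNIV _ H(1)] by auto
  then have "H q0 ^ j \<le> H q ^ j" for q
    using H(2)[of q0] by (intro power_mono) auto
  moreover have "0 \<le> H q ^ j" for q
    using H(2)[of q] by simp
  ultimately have le: "measure torus_lebesgue (UNIV :: 'n torus set) * H q0 ^ j \<le> (\<integral>r. H r ^ j \<partial>torus_lebesgue)"
    using H(2)[of q0] by (intro integral_torus_ge_measure continuous_on_power H(1)) auto
  have "0 < measure torus_lebesgue (UNIV :: 'n torus set) * H q0 ^ j"
    using H(2)[of q0] by (intro mult_pos_pos measure_torus_lebesgue_open_pos) auto
  also note le
  finally show pos: "0 < (\<integral>r. H r ^ j \<partial>torus_lebesgue)" .
  show "continuous_on UNIV (peak H j)"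
    unfolding peak_def using pos by (intro continuous_intros H(1)) auto
  show "0 < peak H j q"
    unfolding peak_def using pos H(2) by simp
  show "(\<integral>q. peak H j q \<partial>torus_lebesgue) = 1"
    unfolding peak_def using pos by simp
qed

text \<open>Where \<open>f\<close> differs from \<open>f 0\<close> by at least \<open>e\<close>,
  \<open>H\<close> stays below some \<open>m\<close>; on an open set of mass \<open>v\<close> it
  exceeds a larger \<open>m'\<close>. There the kernel is at most \<open>(m / m') ^ j / v\<close>;
  elsewhere \<open>f\<close> is within \<open>e\<close> of \<open>f 0\<close>.\<close>

lemma peak_concentrates:
  fixes H f :: "'n::finite torus \<Rightarrow> real"
  assumes H: "continuous_on UNIV H" "\<And>q. 0 < H q" "\<And>q. q \<noteq> 0 \<Longrightarrow> H q < H 0"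
    and f: "continuous_on UNIV f"
  shows "(\<lambda>j. \<integral>q. peak H j q * f q \<partial>torus_lebesgue) \<longlonglongrightarrow> f 0"
proof (rule tendstoI)
  fix \<epsilon> :: real assume "0 < \<epsilon>"
  define e where "e = \<epsilon> / 2"
  have e: "0 < e"
    using \<open>0 < \<epsilon>\<close> by (simp add: e_def)
  note int = integrable_continuous_torus[OF torus_lebesgue_borel_probs]
  interpret prob_space "torus_lebesgue :: 'n torus measure"
    by (rule borel_probsD(1)[OF torus_lebesgue_borel_probs])
  define A where "A = {q. e \<le> \<bar>f q - f 0\<bar>}"
  have "closed A"
    unfolding A_def by (intro closed_Collect_le continuous_intros f)
  then have "compact A"
    using compact_Int_closed[OF compact_torus_UNIV] by simp
  have "0 \<notin> A"
    using e by (simp add: A_def)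
  \<comment> \<open>The maximum of \<open>H\<close> on the compact set \<open>A\<close>, which
    misses zero; for empty \<open>A\<close> any positive value below \<open>H 0\<close>
    serves.\<close>
  obtain m where m: "0 < m" "m < H 0" "\<And>q. q \<in> A \<Longrightarrow> H q \<le> m"
  proof (cases "A = {}")
    case True
    then show thesis
      using that[of "H 0 / 2"] H(2)[of 0] by simp
  next
    case False
    obtain q1 where "q1 \<in> A" "\<And>q. q \<in> A \<Longrightarrow> H q \<le> H q1"
      using continuous_attains_sup[OF \<open>compact A\<close> False continuous_on_subset[OF H(1) subset_UNIV]] by blast
    moreover have "q1 \<noteq> 0"
      using \<open>q1 \<in> A\<close> \<open>0 \<notin> A\<close> by auto
    ultimately show thesis
      using that[of "H q1"] H(2,3) by blast
  qed
  \<comment> \<open>Strictly between \<open>m\<close> and \<open>H 0\<close>: the ratio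
    \<open>m / m'\<close> is below 1, and the set where \<open>H\<close> exceeds \<open>m'\<close>
    contains zero.\<close>
  define m' where "m' = (m + H 0) / 2"
  have m': "0 < m'" "m < m'" "m' < H 0"
    using m by (auto simp: m'_def)
  define B where "B = {q. m' < H q}"
  have B: "open B" "B \<noteq> {}"
    using m'(3) by (auto simp: B_def intro!: open_Collect_less continuous_intros H(1))
  define v where "v = measure torus_lebesgue B"
  have v: "0 < v" "v * m' ^ j \<le> (\<integral>r. H r ^ j \<partial>torus_lebesgue)" for j
  proof -
    have "m' ^ j \<le> H q ^ j" if "q \<in> B" for q
      using that m'(1) by (intro power_mono) (auto simp: B_def)
    moreover have "0 \<le> H q ^ j" for q
      using H(2)[of q] by simp
    ultimately show "v * m' ^ j \<le> (\<integral>r. H r ^ j \<partial>torus_lebesgue)"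
      unfolding v_def using m'(1) B by (intro integral_torus_ge_measure continuous_on_power H(1)) auto
    show "0 < v"
      unfolding v_def by (rule measure_torus_lebesgue_open_pos[OF B])
  qed
  have "continuous_on UNIV (\<lambda>q. f q - f 0)"
    by (intro continuous_intros f)
  then obtain D where D: "0 < D" "\<And>q. \<bar>f q - f 0\<bar> \<le> D"
    using continuous_torus_bounded by (metis real_norm_def)
  note p = peak_props[OF H(1,2)]
  have bound: "dist (\<integral>q. peak H j q * f q \<partial>torus_lebesgue) (f 0) \<le> e + D / v * (m / m') ^ j" for j
  proof -
    have pw: "peak H j q * \<bar>f q - f 0\<bar> \<le> e * peak H j q + D / v * (m / m') ^ j" for q
    proof (cases "q \<in> A")
      case True
      have "peak H j q \<le> m ^ j / (v * m' ^ j)"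
        unfolding peak_def using v m' m(3)[OF True] H(2)[of q] by (intro frac_le power_mono) (auto intro: less_imp_le)
      then have "peak H j q * \<bar>f q - f 0\<bar> \<le> m ^ j / (v * m' ^ j) * D"
        using D m(1) m'(1) v(1) by (intro mult_mono) auto
      also have "\<dots> = D / v * (m / m') ^ j"
        by (simp add: power_divide)
      also have "\<dots> \<le> e * peak H j q + D / v * (m / m') ^ j"
        using e p(3)[of j q] by simp
      finally show ?thesis .
    next
      case False
      then have "peak H j q * \<bar>f q - f 0\<bar> \<le> peak H j q * e"
        using p(3)[of j q] by (intro mult_left_mono) (auto simp: A_def)
      moreover have "0 \<le> D / v * (m / m') ^ j"
        using D(1) v(1) m(1) m'(1) by simp
      ultimately show ?thesis
        by (simp add: mult.commute)
    qed
    have i: "integrable torus_lebesgue (\<lambda>q. peak H j q * f q)"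
      "integrable torus_lebesgue (\<lambda>q. peak H j q * f 0)"
      "integrable torus_lebesgue (\<lambda>q. peak H j q * \<bar>f q - f 0\<bar>)"
      "integrable torus_lebesgue (\<lambda>q. e * peak H j q)"
      by (intro int continuous_intros p(2) f)+
    have "dist (\<integral>q. peak H j q * f q \<partial>torus_lebesgue) (f 0) =
        \<bar>(\<integral>q. peak H j q * f q \<partial>torus_lebesgue) - (\<integral>q. peak H j q * f 0 \<partial>torus_lebesgue)\<bar>"
      using p(4)[of j] by (simp add: dist_real_def)
    also have "\<dots> = \<bar>\<integral>q. peak H j q * f q - peak H j q * f 0 \<partial>torus_lebesgue\<bar>"
      using i(1,2) by (subst Bochner_Integration.integral_diff) auto
    also have "\<dots> \<le> (\<integral>q. \<bar>peak H j q * f q - peak H j q * f 0\<bar> \<partial>torus_lebesgue)"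
      by (rule integral_abs_bound)
    also have "\<dots> = (\<integral>q. peak H j q * \<bar>f q - f 0\<bar> \<partial>torus_lebesgue)"
      by (rule Bochner_Integration.integral_cong[OF refl])
        (use p(3)[of j] in \<open>simp add: right_diff_distrib[symmetric] abs_mult less_imp_le\<close>)
    also have "\<dots> \<le> (\<integral>q. e * peak H j q + D / v * (m / m') ^ j \<partial>torus_lebesgue)"
      using i(3,4) pw by (intro integral_mono) auto
    also have "\<dots> = (\<integral>q. e * peak H j q \<partial>torus_lebesgue) + D / v * (m / m') ^ j"
      using i(4) by (subst Bochner_Integration.integral_add) (auto simp: prob_space)
    also have "\<dots> = e + D / v * (m / m') ^ j"
      using p(4)[of j] by simp
    finally show ?thesis .
  qed
  have "(\<lambda>j. D / v * (m / m') ^ j) \<longlonglongrightarrow> D / v * 0"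
    using m(1) m'(1,2) by (intro tendsto_intros LIMSEQ_power_zero) simp
  then have "\<forall>\<^sub>F j in sequentially. D / v * (m / m') ^ j < e"
    by (rule order_tendstoD) (use e in simp)
  then show "\<forall>\<^sub>F j in sequentially. dist (\<integral>q. peak H j q * f q \<partial>torus_lebesgue) (f 0) < \<epsilon>"
  proof eventually_elim
    case (elim j)
    with bound[of j] have "dist (\<integral>q. peak H j q * f q \<partial>torus_lebesgue) (f 0) < e + e"
      by linarith
    then show ?case
      by (simp add: e_def)
  qed
qed

text \<open>By the duality formula the convolution acts on the test function. The smoothed function
  tends to \<open>f\<close> pointwise by concentration and keeps the bound of \<open>f\<close>, so
  dominated convergence applies.\<close>

lemma weak_star_conv_torus_conv:
  fixes \<eta> :: "nat \<Rightarrow> 'n::finite torus \<Rightarrow> real"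
  assumes \<mu>: "\<mu> \<in> borel_probs"
    and \<eta>: "\<And>j. continuous_on UNIV (\<eta> j)" "\<And>j. (\<integral>q. \<eta> j q \<partial>torus_lebesgue) = 1" "\<And>j q. 0 \<le> \<eta> j q"
    and conc: "\<And>f. continuous_on UNIV f \<Longrightarrow> (\<lambda>j. \<integral>q. \<eta> j q * f q \<partial>torus_lebesgue) \<longlonglongrightarrow> f 0"
    and \<rho>: "\<And>j. continuous_on UNIV (torus_conv (\<eta> j) \<mu>)"
  shows "weak_star_conv (\<lambda>j. density torus_lebesgue (\<lambda>x. ennreal (torus_conv (\<eta> j) \<mu> x))) \<mu>"
  unfolding weak_star_conv_def
proof (intro allI impI)
  fix f :: "'n torus \<Rightarrow> real" assume f: "continuous_on UNIV f"
  interpret prob_space \<mu> by (rule borel_probsD(1)[OF \<mu>])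
  obtain B where B: "0 < B" "\<And>x. norm (f x) \<le> B"
    using continuous_torus_bounded[OF f] by metis
  have eq: "(\<integral>x. f x \<partial>density torus_lebesgue (\<lambda>x. ennreal (torus_conv (\<eta> j) \<mu> x))) =
      (\<integral>y. (\<integral>q. \<eta> j q * f (q + y) \<partial>torus_lebesgue) \<partial>\<mu>)" for j
    using integral_density_torus[OF \<rho> _ f] integral_torus_conv[OF \<mu> f \<eta>(1)]
    by (simp add: torus_conv_def \<eta>(3))
  have "(\<lambda>j. \<integral>y. (\<integral>q. \<eta> j q * f (q + y) \<partial>torus_lebesgue) \<partial>\<mu>) \<longlonglongrightarrow> (\<integral>y. f y \<partial>\<mu>)"
  proof (rule integral_dominated_convergence[where w = "\<lambda>_. B"])
    show "f \<in> borel_measurable \<mu>"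
      by (rule measurable_continuous_borel_probs[OF \<mu> f])
    show "(\<lambda>y. \<integral>q. \<eta> j q * f (q + y) \<partial>torus_lebesgue) \<in> borel_measurable \<mu>" for j
    proof -
      have "continuous_on UNIV (\<lambda>z. \<eta> j (snd z) * f (fst z + snd z))"
        by (intro continuous_on_mult continuous_on_torus_plus_fst_snd f continuous_on_compose2[OF \<eta>(1)])
          (auto intro: continuous_on_snd continuous_on_id)
      from Fubini_torus(2)[OF \<mu> torus_lebesgue_borel_probs this] show ?thesis
        by (simp add: add.commute)
    qed
    show "integrable \<mu> (\<lambda>_. B)"
      by simp
    show "AE y in \<mu>. (\<lambda>j. \<integral>q. \<eta> j q * f (q + y) \<partial>torus_lebesgue) \<longlonglongrightarrow> f y"
    proof (rule AE_I2)
      fix y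
      show "(\<lambda>j. \<integral>q. \<eta> j q * f (q + y) \<partial>torus_lebesgue) \<longlonglongrightarrow> f y"
        using conc[OF continuous_on_torus_plus_const[OF f, of y]] by simp
    qed
    show "AE y in \<mu>. norm (\<integral>q. \<eta> j q * f (q + y) \<partial>torus_lebesgue) \<le> B" for j
    proof (rule AE_I2)
      fix y
      have "norm (\<integral>q. \<eta> j q * f (q + y) \<partial>torus_lebesgue) \<le> (\<integral>q. norm (\<eta> j q * f (q + y)) \<partial>torus_lebesgue)"
        by (rule integral_norm_bound)
      also have "\<dots> \<le> (\<integral>q. \<eta> j q * B \<partial>torus_lebesgue)"
        by (intro integral_mono integrable_continuous_torus[OF torus_lebesgue_borel_probs]
            continuous_intros \<eta>(1) continuous_on_torus_plus_const f)
          (use B(2) \<eta>(3) in \<open>auto simp: abs_mult intro!: mult_left_mono\<close>)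
      also have "\<dots> = B"
        using \<eta>(2) by simp
      finally show "norm (\<integral>q. \<eta> j q * f (q + y) \<partial>torus_lebesgue) \<le> B" .
    qed
  qed
  then show "(\<lambda>j. \<integral>x. f x \<partial>density torus_lebesgue (\<lambda>x. ennreal (torus_conv (\<eta> j) \<mu> x))) \<longlonglongrightarrow> (\<integral>x. f x \<partial>\<mu>)"
    by (simp add: eq)
qed

section \<open>Trigonometric polynomials\<close>

text \<open>Periodicity makes the value independent of the representative; see
  \<open>tcos_abs\<close>.\<close>

definition tcos :: "'n::finite \<Rightarrow> 'n torus \<Rightarrow> real" where
  "tcos i q = cos (2 * pi * rep_torus q $ i)"

definition tsin :: "'n::finite \<Rightarrow> 'n torus \<Rightarrow> real" where
  "tsin i q = sin (2 * pi * rep_torus q $ i)"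

lemma tcos_abs [simp]: "tcos i (abs_torus x) = cos (2 * pi * x $ i)"
  and tsin_abs [simp]: "tsin i (abs_torus x) = sin (2 * pi * x $ i)"
proof -
  obtain n where "rep_torus (abs_torus x) $ i - x $ i = of_int n"
    using torus_rel_rep_abs[of x] unfolding torus_rel_def Ints_def by blast
  then have "2 * pi * rep_torus (abs_torus x) $ i = 2 * pi * x $ i + 2 * pi * of_int n"
    by (simp add: algebra_simps)
  then show "tcos i (abs_torus x) = cos (2 * pi * x $ i)" "tsin i (abs_torus x) = sin (2 * pi * x $ i)"
    unfolding tcos_def tsin_def by (simp_all add: cos_add sin_add)
qed

lemma tcos_diff: "tcos i (x - y) = tcos i x * tcos i y + tsin i x * tsin i y"
  and tsin_diff: "tsin i (x - y) = tsin i x * tcos i y - tcos i x * tsin i y"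
proof -
  obtain a b where "x = abs_torus a" "y = abs_torus b"
    by (metis abs_rep_torus)
  then show "tcos i (x - y) = tcos i x * tcos i y + tsin i x * tsin i y"
    "tsin i (x - y) = tsin i x * tcos i y - tcos i x * tsin i y"
    by (simp_all add: minus_torus.abs_eq right_diff_distrib cos_diff sin_diff)
qed

text \<open>The algebra generated by the coordinate cosines and sines. Its stability under
  differentiation and convolution gives smoothness of the approximating densities.\<close>

inductive trig_poly :: "('n::finite torus \<Rightarrow> real) \<Rightarrow> bool" where
  const: "trig_poly (\<lambda>_. c)"
| cos: "trig_poly (tcos i)"
| sin: "trig_poly (tsin i)"
| add: "trig_poly f \<Longrightarrow> trig_poly g \<Longrightarrow> trig_poly (\<lambda>q. f q + g q)"
| mult: "trig_poly f \<Longrightarrow> trig_poly g \<Longrightarrow> trig_poly (\<lambda>q. f q * g q)"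

lemma trig_poly_sum: "finite A \<Longrightarrow> (\<And>i. i \<in> A \<Longrightarrow> trig_poly (f i)) \<Longrightarrow> trig_poly (\<lambda>q. \<Sum>i\<in>A. f i q)"
  by (induction rule: finite_induct) (auto intro: trig_poly.intros)

lemma trig_poly_power: "trig_poly f \<Longrightarrow> trig_poly (\<lambda>q. f q ^ j)"
  by (induction j) (auto intro: trig_poly.intros)

lemma trig_poly_has_derivative:
  assumes "trig_poly f"
  obtains D where "\<And>i. trig_poly (D i)"
    "\<And>x. ((f \<circ> abs_torus) has_derivative (\<lambda>h. \<Sum>i\<in>UNIV. h $ i * D i (abs_torus x))) (at x)"
proof -
  have "\<exists>D. (\<forall>i. trig_poly (D i)) \<and>
    (\<forall>x. ((\<lambda>x. f (abs_torus x)) has_derivative (\<lambda>h. \<Sum>i\<in>UNIV. h $ i * D i (abs_torus x))) (at x))"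
    using assms
  proof induction
    case (const c)
    show ?case
      by (rule exI[of _ "\<lambda>_ _. 0"]) (auto intro: trig_poly.const)
  next
    case (cos j)
    \<comment> \<open>The case distinction sits in the constant factor, so each coefficient is
      visibly a constant times a generator.\<close>
    let ?D = "\<lambda>i q. (if i = j then - 2 * pi else 0) * tsin j q"
    have "(\<Sum>i\<in>UNIV. h $ i * ?D i q) = (\<Sum>i\<in>UNIV. if i = j then h $ i * (- 2 * pi * tsin j q) else 0)" for h q
      by (intro sum.cong) auto
    then have sum: "(\<Sum>i\<in>UNIV. h $ i * ?D i q) = h $ j * (- 2 * pi * tsin j q)" for h q
      by simp
    have deriv: "((\<lambda>x. tcos j (abs_torus x)) has_derivative (\<lambda>h. h $ j * (- 2 * pi * tsin j (abs_torus x)))) (at x)" for x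
      by (auto intro!: derivative_eq_intros bounded_linear_imp_has_derivative[OF bounded_linear_vec_nth])
    show ?case
    proof (intro exI[of _ ?D] conjI allI)
      show "trig_poly (?D i)" for i
        by (intro trig_poly.intros)
      show "((\<lambda>x. tcos j (abs_torus x)) has_derivative (\<lambda>h. \<Sum>i\<in>UNIV. h $ i * ?D i (abs_torus x))) (at x)" for x
        unfolding sum by (rule deriv)
    qed
  next
    case (sin j)
    let ?D = "\<lambda>i q. (if i = j then 2 * pi else 0) * tcos j q"
    have "(\<Sum>i\<in>UNIV. h $ i * ?D i q) = (\<Sum>i\<in>UNIV. if i = j then h $ i * (2 * pi * tcos j q) else 0)" for h q
      by (intro sum.cong) auto
    then have sum: "(\<Sum>i\<in>UNIV. h $ i * ?D i q) = h $ j * (2 * pi * tcos j q)" for h q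
      by simp
    have deriv: "((\<lambda>x. tsin j (abs_torus x)) has_derivative (\<lambda>h. h $ j * (2 * pi * tcos j (abs_torus x)))) (at x)" for x
      by (auto intro!: derivative_eq_intros bounded_linear_imp_has_derivative[OF bounded_linear_vec_nth])
    show ?case
    proof (intro exI[of _ ?D] conjI allI)
      show "trig_poly (?D i)" for i
        by (intro trig_poly.intros)
      show "((\<lambda>x. tsin j (abs_torus x)) has_derivative (\<lambda>h. \<Sum>i\<in>UNIV. h $ i * ?D i (abs_torus x))) (at x)" for x
        unfolding sum by (rule deriv)
    qed
  next
    case (add f g)
    from add.IH(1) obtain D where D: "\<And>i. trig_poly (D i)"
      "\<And>x. ((\<lambda>x. f (abs_torus x)) has_derivative (\<lambda>h. \<Sum>i\<in>UNIV. h $ i * D i (abs_torus x))) (at x)"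
      by blast
    from add.IH(2) obtain E where E: "\<And>i. trig_poly (E i)"
      "\<And>x. ((\<lambda>x. g (abs_torus x)) has_derivative (\<lambda>h. \<Sum>i\<in>UNIV. h $ i * E i (abs_torus x))) (at x)"
      by blast
    have eq: "(\<Sum>i\<in>UNIV. h $ i * (D i q + E i q)) = (\<Sum>i\<in>UNIV. h $ i * D i q) + (\<Sum>i\<in>UNIV. h $ i * E i q)" for h q
      by (simp add: sum.distrib distrib_left)
    show ?case
    proof (intro exI[of _ "\<lambda>i q. D i q + E i q"] conjI allI)
      show "trig_poly (\<lambda>q. D i q + E i q)" for i
        by (rule trig_poly.add[OF D(1) E(1)])
      show "((\<lambda>x. f (abs_torus x) + g (abs_torus x)) has_derivative
          (\<lambda>h. \<Sum>i\<in>UNIV. h $ i * (D i (abs_torus x) + E i (abs_torus x)))) (at x)" for x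
        unfolding eq by (rule has_derivative_add[OF D(2) E(2)])
    qed
  next
    case (mult f g)
    from mult.IH(1) obtain D where D: "\<And>i. trig_poly (D i)"
      "\<And>x. ((\<lambda>x. f (abs_torus x)) has_derivative (\<lambda>h. \<Sum>i\<in>UNIV. h $ i * D i (abs_torus x))) (at x)"
      by blast
    from mult.IH(2) obtain E where E: "\<And>i. trig_poly (E i)"
      "\<And>x. ((\<lambda>x. g (abs_torus x)) has_derivative (\<lambda>h. \<Sum>i\<in>UNIV. h $ i * E i (abs_torus x))) (at x)"
      by blast
    have eq: "(\<Sum>i\<in>UNIV. h $ i * (f q * E i q + D i q * g q)) =
        f q * (\<Sum>i\<in>UNIV. h $ i * E i q) + (\<Sum>i\<in>UNIV. h $ i * D i q) * g q" for h q
      unfolding sum_distrib_left sum_distrib_right sum.distrib[symmetric]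
      by (intro sum.cong) (simp_all add: algebra_simps)
    show ?case
    proof (intro exI[of _ "\<lambda>i q. f q * E i q + D i q * g q"] conjI allI)
      show "trig_poly (\<lambda>q. f q * E i q + D i q * g q)" for i
        by (intro trig_poly.add trig_poly.mult D(1) E(1) mult.hyps)
      show "((\<lambda>x. f (abs_torus x) * g (abs_torus x)) has_derivative
          (\<lambda>h. \<Sum>i\<in>UNIV. h $ i * (f (abs_torus x) * E i (abs_torus x) + D i (abs_torus x) * g (abs_torus x)))) (at x)" for x
        unfolding eq by (rule has_derivative_mult[OF D(2) E(2)])
    qed
  qed
  then obtain D where "\<And>i. trig_poly (D i)"
    "\<And>x. ((\<lambda>x. f (abs_torus x)) has_derivative (\<lambda>h. \<Sum>i\<in>UNIV. h $ i * D i (abs_torus x))) (at x)"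
    by blast
  then show thesis
    using that[of D] by (simp add: comp_def)
qed

lemma trig_poly_continuous:
  assumes "trig_poly f"
  shows "continuous_on UNIV f"
proof -
  obtain D where "\<And>i. trig_poly (D i)"
    and D: "\<And>x. ((f \<circ> abs_torus) has_derivative (\<lambda>h. \<Sum>i\<in>UNIV. h $ i * D i (abs_torus x))) (at x)"
    using trig_poly_has_derivative[OF assms] by blast
  have "continuous_on UNIV (f \<circ> abs_torus)"
    by (intro continuous_at_imp_continuous_on ballI has_derivative_continuous[OF D])
  then show ?thesis
    by (simp add: continuous_on_torus_iff comp_def)
qed

text \<open>Induction on the order, for all trigonometric polynomials at once, since the partial
  derivatives stay in the class.\<close>

lemma trig_poly_smooth:
  assumes "trig_poly f"
  shows "smooth_torus f"
proof -
  have "Ck k (f \<circ> abs_torus)" for k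
    using assms
  proof (induction k arbitrary: f)
    case 0
    then show ?case
      using trig_poly_continuous by (simp add: continuous_on_torus_iff comp_def)
  next
    case (Suc k)
    obtain D where D: "\<And>i. trig_poly (D i)"
      "\<And>x. ((f \<circ> abs_torus) has_derivative (\<lambda>h. \<Sum>i\<in>UNIV. h $ i * D i (abs_torus x))) (at x)"
      using trig_poly_has_derivative[OF Suc.prems] by blast
    have "frechet_derivative (f \<circ> abs_torus) (at x) (axis i 1) = (D i \<circ> abs_torus) x" for x i
    proof -
      have "(\<Sum>l\<in>UNIV. axis i 1 $ l * D l (abs_torus x)) = (\<Sum>l\<in>UNIV. if l = i then D l (abs_torus x) else 0)"
        by (intro sum.cong) (auto simp: axis_def)
      then show ?thesis
        by (simp add: frechet_derivative_eqI[OF D(2)])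
    qed
    then have eq: "(\<lambda>x. frechet_derivative (f \<circ> abs_torus) (at x) (axis i 1)) = D i \<circ> abs_torus" for i
      by blast
    have "(f \<circ> abs_torus) differentiable (at x)" for x
      using D(2)[of x] by (rule differentiableI)
    with Suc.IH[OF D(1)] show ?case
      by (simp only: Ck.simps eq simp_thms)
  qed
  then show ?thesis
    by (simp add: smooth_torus_def)
qed

text \<open>Since \<open>cos (s - t)\<close> and \<open>sin (s - t)\<close> are separable in \<open>s\<close> and \<open>t\<close>, convolving a trigonometric
  polynomial with a measure gives a trigonometric polynomial again; this replaces differentiation
  under the integral sign.\<close>

inductive separable :: "('n::finite torus \<Rightarrow> 'n torus \<Rightarrow> real) \<Rightarrow> bool" where
  prod: "trig_poly a \<Longrightarrow> trig_poly b \<Longrightarrow> separable (\<lambda>x y. a x * b y)"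
| plus: "separable K \<Longrightarrow> separable L \<Longrightarrow> separable (\<lambda>x y. K x y + L x y)"

lemma separable_mult:
  assumes "separable K" "separable L"
  shows "separable (\<lambda>x y. K x y * L x y)"
  using assms(1)
proof induction
  case (prod a b)
  show ?case
    using assms(2)
  proof induction
    case (prod a' b')
    have "separable (\<lambda>x y. (a x * a' x) * (b y * b' y))"
      by (intro separable.prod trig_poly.mult prod \<open>trig_poly a\<close> \<open>trig_poly b\<close>)
    then show ?case
      by (simp add: mult_ac)
  next
    case (plus K L)
    then show ?case
      by (simp add: distrib_left separable.plus)
  qed
next
  case (plus K L)
  then show ?case
    by (simp add: distrib_right separable.plus)
qed

lemma trig_poly_diff_separable:
  assumes "trig_poly f"
  shows "separable (\<lambda>x y. f (x - y))"
  using assms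
proof induction
  case (const c)
  show ?case
    using separable.prod[OF trig_poly.const[of c] trig_poly.const[of 1]] by simp
next
  case (cos i)
  show ?case
    unfolding tcos_diff by (intro separable.intros trig_poly.intros)
next
  case (sin i)
  have "separable (\<lambda>x y. tsin i x * tcos i y + (-1 * tcos i x) * tsin i y)"
    by (intro separable.intros trig_poly.intros)
  then show ?case
    by (simp add: tsin_diff)
next
  case (add f g)
  then show ?case
    by (intro separable.plus)
next
  case (mult f g)
  then show ?case
    by (intro separable_mult)
qed

lemma separable_integral:
  assumes "\<mu> \<in> borel_probs" "separable K"
  shows "trig_poly (\<lambda>x. \<integral>y. K x y \<partial>\<mu>)"
proof -
  \<comment> \<open>Integrability is carried through the induction because the integral of a sum is
    split.\<close>
  have "(\<forall>x. integrable \<mu> (K x)) \<and> trig_poly (\<lambda>x. \<integral>y. K x y \<partial>\<mu>)"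
    using assms(2)
  proof induction
    case (prod a b)
    then show ?case
      using integrable_continuous_torus[OF assms(1) trig_poly_continuous[OF prod(2)]]
      by (auto intro: trig_poly.intros)
  next
    case (plus K L)
    then show ?case
      by (auto intro: trig_poly.intros)
  qed
  then show ?thesis by blast
qed

lemma trig_poly_torus_conv:
  assumes "\<mu> \<in> borel_probs" "trig_poly \<eta>"
  shows "trig_poly (torus_conv \<eta> \<mu>)"
  unfolding torus_conv_def[abs_def]
  by (rule separable_integral[OF assms(1) trig_poly_diff_separable[OF assms(2)]])

lemma trig_poly_peak: "trig_poly H \<Longrightarrow> trig_poly (peak H j)"
  using trig_poly.mult[OF trig_poly_power trig_poly.const, of H j "1 / (\<integral>r. H r ^ j \<partial>torus_lebesgue)"]
  by (simp add: peak_def[abs_def])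

lemma trig_poly_unique_peak:
  obtains H :: "'n::finite torus \<Rightarrow> real"
  where "trig_poly H" "\<And>q. 0 < H q" "\<And>q. q \<noteq> 0 \<Longrightarrow> H q < H 0"
proof
  \<comment> \<open>Each summand is at least 1 and is largest exactly where its coordinate is an
    integer; all coordinates are integers only at the point zero of the torus.\<close>
  let ?H = "\<lambda>q :: 'n torus. \<Sum>i\<in>UNIV. 2 + tcos i q"
  show "trig_poly ?H"
    by (intro trig_poly_sum trig_poly.intros finite)
  have pos: "0 < 2 + tcos i q" for i and q :: "'n torus"
    using cos_ge_minus_one[of "2 * pi * rep_torus q $ i"] unfolding tcos_def by linarith
  show "0 < ?H q" for q
    by (rule sum_pos) (use pos in auto)
  show "?H q < ?H 0" if "q \<noteq> 0" for q
  proof (rule sum_strict_mono_ex1)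
    obtain x where q: "q = abs_torus x"
      by (rule torus_cases_abs)
    have zero: "tcos i 0 = 1" for i :: 'n
      by (simp add: zero_torus.abs_eq)
    show "\<forall>i\<in>UNIV. 2 + tcos i q \<le> 2 + tcos i 0"
      by (simp add: zero) (simp add: tcos_def)
    from that obtain i where i: "x $ i \<notin> \<int>"
      by (auto simp: q zero_torus.abs_eq abs_torus_eq_iff torus_rel_def)
    have "cos (2 * pi * x $ i) \<noteq> 1"
    proof
      assume "cos (2 * pi * x $ i) = 1"
      then obtain n :: int where "2 * pi * x $ i = of_int n * 2 * pi"
        by (auto simp: cos_one_2pi_int)
      then have "x $ i = of_int n"
        by simp
      with i show False by simp
    qed
    moreover have "cos (2 * pi * x $ i) \<le> 1"
      by simp
    ultimately show "\<exists>i\<in>UNIV. 2 + tcos i q < 2 + tcos i 0"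
      by (intro bexI[of _ i]) (simp_all add: zero q less_le)
  qed simp
qed

section \<open>Positive smooth approximations and the conclusion\<close>

lemma torus_conv_pos:
  fixes \<eta> :: "'n::finite torus \<Rightarrow> real"
  assumes \<mu>: "\<mu> \<in> borel_probs" and \<eta>: "continuous_on UNIV \<eta>" "\<And>q. 0 < \<eta> q"
  shows "0 < torus_conv \<eta> \<mu> x"
proof -
  interpret prob_space \<mu> by (rule borel_probsD(1)[OF \<mu>])
  \<comment> \<open>The positive minimum of \<eta> on the compact torus bounds the convolution
    below, since \<mu> has mass 1.\<close>
  obtain q0 where q0: "\<And>q. \<eta> q0 \<le> \<eta> q"
    using continuous_attains_inf[OF compact_torus_UNIV _ \<eta>(1)] by auto
  have "continuous_on UNIV (\<lambda>y. \<eta> (x - y))"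
    using continuous_on_compose2[OF continuous_on_torus_minus_fst_snd[OF \<eta>(1)], of UNIV "\<lambda>y. (x, y)"]
    by (simp add: continuous_on_Pair continuous_on_const continuous_on_id)
  then have int: "integrable \<mu> (\<lambda>y. \<eta> (x - y))"
    by (rule integrable_continuous_torus[OF \<mu>])
  have "0 < (\<integral>y. \<eta> q0 \<partial>\<mu>)"
    using \<eta>(2) by (simp add: prob_space)
  also have "\<dots> \<le> torus_conv \<eta> \<mu> x"
    unfolding torus_conv_def using int q0 by (intro integral_mono) auto
  finally show ?thesis .
qed

lemma smooth_approximation:
  fixes \<mu> :: "'n::finite torus measure"
  assumes \<mu>: "\<mu> \<in> borel_probs"
  obtains \<rho> :: "nat \<Rightarrow> 'n torus \<Rightarrow> real"
  where "\<And>j. smooth_torus (\<rho> j)" "\<And>j x. 0 < \<rho> j x"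
    "\<And>j. density torus_lebesgue (\<lambda>x. ennreal (\<rho> j x)) \<in> borel_probs"
    "weak_star_conv (\<lambda>j. density torus_lebesgue (\<lambda>x. ennreal (\<rho> j x))) \<mu>"
    "\<And>P. (\<lambda>j. F (density torus_lebesgue (\<lambda>x. ennreal (\<rho> j x))) P) \<longlonglongrightarrow> F \<mu> P"
proof -
  obtain H :: "'n torus \<Rightarrow> real"
    where H: "trig_poly H" "\<And>q. 0 < H q" "\<And>q. q \<noteq> 0 \<Longrightarrow> H q < H 0"
    using trig_poly_unique_peak by blast
  note contH = trig_poly_continuous[OF H(1)]
  note p = peak_props[OF contH H(2)]
  define \<rho> where "\<rho> j = torus_conv (peak H j) \<mu>" for j
  have trig: "trig_poly (\<rho> j)" for j
    unfolding \<rho>_def by (rule trig_poly_torus_conv[OF \<mu> trig_poly_peak[OF H(1)]])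
  note cont = trig_poly_continuous[OF trig, unfolded \<rho>_def]
  have pos: "0 < \<rho> j x" for j x
    unfolding \<rho>_def by (rule torus_conv_pos[OF \<mu> p(2,3)])
  have prob: "density torus_lebesgue (\<lambda>x. ennreal (\<rho> j x)) \<in> borel_probs" for j
    using density_torus_conv_borel_probs[OF \<mu> p(2,4) cont less_imp_le[OF pos[unfolded \<rho>_def]]]
    by (simp add: \<rho>_def)
  have conv: "weak_star_conv (\<lambda>j. density torus_lebesgue (\<lambda>x. ennreal (\<rho> j x))) \<mu>"
    unfolding \<rho>_def
    by (rule weak_star_conv_torus_conv[OF \<mu> p(2,4) less_imp_le[OF p(3)] peak_concentrates[OF contH H(2,3)] cont])
  \<comment> \<open>The kernels do not involve \<open>P\<close>, so one sequence serves every
    \<open>P\<close>.\<close>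
  have "(\<lambda>j. F (density torus_lebesgue (\<lambda>x. ennreal (\<rho> j x))) P) \<longlonglongrightarrow> F \<mu> P" for P
    by (rule F_tendsto_if_ge[OF conv])
      (simp add: \<rho>_def F_le_F_conv[OF \<mu> p(2,4) less_imp_le[OF p(3)] cont])
  with trig_poly_smooth[OF trig] pos prob conv show thesis
    by (rule that)
qed

theorem theorem4p2:
  shows "(\<forall>(P :: real ^ 'n::finite) (\<mu>s :: nat \<Rightarrow> 'n torus measure) (\<mu> :: 'n torus measure)
            (\<nu>s :: nat \<Rightarrow> ('n torus \<times> (real ^ 'n)) measure).
            (\<forall>j. \<mu>s j \<in> borel_probs) \<and> \<mu> \<in> borel_probs \<and> weak_star_conv \<mu>s \<mu> \<and>
            (\<lambda>j. F (\<mu>s j) P) \<longlonglongrightarrow> F \<mu> P \<and>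
            (\<forall>j. weak_solution (\<mu>s j) P (\<nu>s j)) \<longrightarrow>
            (\<exists>r \<nu>. strict_mono (r :: nat \<Rightarrow> nat) \<and> weak_conv_meas (\<nu>s \<circ> r) \<nu> \<and>
                   weak_solution \<mu> P \<nu>)) \<and>
         (\<forall>\<mu> :: 'n torus measure. \<mu> \<in> borel_probs \<longrightarrow>
            (\<exists>\<rho> :: nat \<Rightarrow> 'n torus \<Rightarrow> real.
               (\<forall>j. smooth_torus (\<rho> j) \<and> (\<forall>x. \<rho> j x > 0) \<and>
                    density torus_lebesgue (\<lambda>x. ennreal (\<rho> j x)) \<in> borel_probs) \<and>
               weak_star_conv (\<lambda>j. density torus_lebesgue (\<lambda>x. ennreal (\<rho> j x))) \<mu> \<and>
               (\<forall>P :: real ^ 'n.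
                  (\<lambda>j. F (density torus_lebesgue (\<lambda>x. ennreal (\<rho> j x))) P) \<longlonglongrightarrow> F \<mu> P)))"
proof (intro conjI allI impI)
  fix P :: "real ^ 'n" and \<mu>s :: "nat \<Rightarrow> 'n torus measure" and \<mu> :: "'n torus measure"
    and \<nu>s :: "nat \<Rightarrow> ('n torus \<times> (real ^ 'n)) measure"
  assume *: "(\<forall>j. \<mu>s j \<in> borel_probs) \<and> \<mu> \<in> borel_probs \<and> weak_star_conv \<mu>s \<mu> \<and>
    (\<lambda>j. F (\<mu>s j) P) \<longlonglongrightarrow> F \<mu> P \<and> (\<forall>j. weak_solution (\<mu>s j) P (\<nu>s j))"
  obtain \<nu> where "\<nu> \<in> Lam \<mu>" "action P \<nu> = - F \<mu> P"
    using * Lam_exists_optimal by blast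
  with * have "weak_solution \<mu> P \<nu>"
    by (simp add: weak_solution_iff)
  moreover from this * have "weak_conv_meas \<nu>s \<nu>"
    by (intro weak_solutions_converge[of \<mu>s \<mu> P \<nu>s \<nu>]) auto
  \<comment> \<open>The whole sequence converges, so the identity is a suitable subsequence.\<close>
  moreover have "strict_mono (id :: nat \<Rightarrow> nat)"
    by (simp add: strict_mono_def)
  ultimately show "\<exists>r \<nu>. strict_mono (r :: nat \<Rightarrow> nat) \<and> weak_conv_meas (\<nu>s \<circ> r) \<nu> \<and> weak_solution \<mu> P \<nu>"
    by (intro exI[of _ id] exI[of _ \<nu>]) simp
next
  fix \<mu> :: "'n torus measure"
  assume "\<mu> \<in> borel_probs"
  from smooth_approximation[OF this]
  obtain \<rho> :: "nat \<Rightarrow> 'n torus \<Rightarrow> real" where \<rho>: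
    "\<And>j. smooth_torus (\<rho> j)" "\<And>j x. 0 < \<rho> j x"
    "\<And>j. density torus_lebesgue (\<lambda>x. ennreal (\<rho> j x)) \<in> borel_probs"
    "weak_star_conv (\<lambda>j. density torus_lebesgue (\<lambda>x. ennreal (\<rho> j x))) \<mu>"
    "\<And>P. (\<lambda>j. F (density torus_lebesgue (\<lambda>x. ennreal (\<rho> j x))) P) \<longlonglongrightarrow> F \<mu> P"
    by blast
  show "\<exists>\<rho> :: nat \<Rightarrow> 'n torus \<Rightarrow> real.
      (\<forall>j. smooth_torus (\<rho> j) \<and> (\<forall>x. \<rho> j x > 0) \<and>
        density torus_lebesgue (\<lambda>x. ennreal (\<rho> j x)) \<in> borel_probs) \<and>
      weak_star_conv (\<lambda>j. density torus_lebesgue (\<lambda>x. ennreal (\<rho> j x))) \<mu> \<and>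
      (\<forall>P :: real ^ 'n. (\<lambda>j. F (density torus_lebesgue (\<lambda>x. ennreal (\<rho> j x))) P) \<longlonglongrightarrow> F \<mu> P)"
    by (intro exI[of _ \<rho>] conjI allI \<rho>)
qed

end
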